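(* Let $\omega=(\omega_0\ldots\omega_{q-1})^\infty\in\{\mathbf{0},\mathbf{1},\mathbf{2}\}^\infty$ be a periodic string of period $q$ which contains all three letters $\mathbf{0},\mathbf{1},\mathbf{2}$. Let $$M_{\mathbf 0}=\begin{pmatrix}2&0&1\\0&2&1\\0&0&1\end{pmatrix},\quad M_{\mathbf 1}=\begin{pmatrix}2&1&0\\0&1&0\\0&1&2\end{pmatrix},\quad M_{\mathbf 2}=\begin{pmatrix}1&0&0\\1&2&0\\1&0&2\end{pmatrix}.$$ Then the growth exponent of the Grigorchuk group $G_\omega$, with generating set $S=\{a,b_\omega,c_\omega,d_\omega\}$, exists and $$\lim_{n\to\infty}\frac{\log\log v_{G_\omega,S}(n)}{\log n}=\alpha_\omega,\qquad \alpha_\omega=\frac{q\log 2}{\log\lambda},$$ where $\lambda$ is the spectral radius of the matrix $M_{\omega_0}\cdots M_{\omega_{q-1}}$.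
   Context: Grigorchuk groups: the rooted binary tree has the finite words over $\{0,1\}$ as vertices. Its automorphism group acts from the right. An automorphism is written $g=(g_0,g_1)\tau$ with $\tau$ a permutation of $\{0,1\}$, meaning $(iw)\cdot g=(i\cdot\tau)(w\cdot g_i)$. Let $\varepsilon$ be the transposition of $0,1$ and $a=(id,id)\varepsilon$. Let $\{id,b,c,d\}$ be the Klein four-group. The letters $\mathbf{0},\mathbf{1},\mathbf{2}$ denote the three non-trivial homomorphisms $\{id,b,c,d\}\to\{id,a\}\cong\mathbb{Z}/2\mathbb{Z}$, with $\mathbf{0},\mathbf{1},\mathbf{2}$ vanishing on $d,c,b$ respectively. For $\omega=\omega_0\omega_1\ldots\in\{\mathbf 0,\mathbf 1,\mathbf 2\}^\infty$ let $\mathfrak{s}\omega=\omega_1\omega_2\ldots$. The automorphisms $b_\omega,c_\omega,d_\omega$ are defined recursively by $x_\omega=(\omega_0(x),x_{\mathfrak{s}\omega})$ for $x\in\{b,c,d\}$. The Grigorchuk group $G_\omega$ is generated by $S=\{a,b_\omega,c_\omega,d_\omega\}$. $v_{G_\omega,S}(n)$ is the number of elements of $G_\omega$ of word length at most $n$ with respect to $S$. *)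

theory Defs
  imports
    Complex_Main
    "HOL-Algebra.Generated_Groups"
    "Jordan_Normal_Form.Spectral_Radius"
begin

text \<open>A vertex is a finite word over \<open>{0,1}\<close>, with \<open>False\<close> for \<open>0\<close> and \<open>True\<close> for \<open>1\<close>.\<close>

type_synonym vertex = "bool list"

definition child :: "vertex \<Rightarrow> vertex \<Rightarrow> bool" where
  "child u v \<longleftrightarrow> (\<exists>i. v = u @ [i])"

text \<open>Automorphisms act from the right, so the product \<open>f g\<close> is ``first \<open>f\<close>, then \<open>g\<close>''.\<close>

definition tree_aut :: "(vertex \<Rightarrow> vertex) monoid" where
  "tree_aut = \<lparr>
     carrier = {f. bij f \<and> f [] = [] \<and> (\<forall>u v. child u v \<longleftrightarrow> child (f u) (f v))},
     monoid.mult = (\<lambda>f g. g \<circ> f),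
     one = id\<rparr>"

text \<open>\<open>wreath g0 g1 \<tau>\<close> is \<open>(g0, g1)\<tau>\<close>, i.e. \<open>(iw) \<cdot> g = (i \<cdot> \<tau>)(w \<cdot> g_i)\<close>.\<close>

fun wreath :: "(vertex \<Rightarrow> vertex) \<Rightarrow> (vertex \<Rightarrow> vertex) \<Rightarrow> (bool \<Rightarrow> bool) \<Rightarrow> vertex \<Rightarrow> vertex" where
  "wreath g0 g1 \<tau> [] = []"
| "wreath g0 g1 \<tau> (i # w) = \<tau> i # (if i then g1 w else g0 w)"

datatype klein = Kid | Kb | Kc | Kd

definition klein_mult :: "klein \<Rightarrow> klein \<Rightarrow> klein" where
  "klein_mult x y =
     (if x = Kid then y else if y = Kid then x else if x = y then Kid
      else (THE z. z \<noteq> Kid \<and> z \<noteq> x \<and> z \<noteq> y))"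

definition klein_four :: "klein monoid" where
  "klein_four = \<lparr>carrier = UNIV, monoid.mult = klein_mult, one = Kid\<rparr>"

datatype letter = L0 | L1 | L2

fun vanishes_on :: "letter \<Rightarrow> klein" where
  "vanishes_on L0 = Kd"
| "vanishes_on L1 = Kc"
| "vanishes_on L2 = Kb"

definition aut_a :: "vertex \<Rightarrow> vertex" where
  "aut_a = wreath id id Not"

text \<open>The lemma \<open>letter_hom_iff\<close> below shows that these are exactly the non-trivial
  homomorphisms from \<open>{id,b,c,d}\<close> to \<open>{id,a}\<close>.\<close>

definition letter_hom :: "letter \<Rightarrow> klein \<Rightarrow> vertex \<Rightarrow> vertex" where
  "letter_hom l x = (if x = Kid \<or> x = vanishes_on l then id else aut_a)"

definition shift :: "(nat \<Rightarrow> letter) \<Rightarrow> nat \<Rightarrow> letter" where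
  "shift \<omega> n = \<omega> (Suc n)"

text \<open>The recursion \<open>x_\<omega> = (\<omega>_0(x), x_{s\<omega>})\<close> is well-founded only pointwise on vertices; the
  equation between automorphisms is the lemma \<open>directed_wreath\<close> below.\<close>

fun directed :: "klein \<Rightarrow> (nat \<Rightarrow> letter) \<Rightarrow> vertex \<Rightarrow> vertex" where
  "directed x \<omega> [] = []"
| "directed x \<omega> (i # w) = i # (if i then directed x (shift \<omega>) w else letter_hom (\<omega> 0) x w)"

definition grigorchuk_gens :: "(nat \<Rightarrow> letter) \<Rightarrow> (vertex \<Rightarrow> vertex) set" where
  "grigorchuk_gens \<omega> = {aut_a, directed Kb \<omega>, directed Kc \<omega>, directed Kd \<omega>}"

definition grigorchuk_group :: "(nat \<Rightarrow> letter) \<Rightarrow> (vertex \<Rightarrow> vertex) monoid" where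
  "grigorchuk_group \<omega> = subgroup_generated tree_aut (grigorchuk_gens \<omega>)"

definition word_prod :: "('a, 'b) monoid_scheme \<Rightarrow> 'a list \<Rightarrow> 'a" where
  "word_prod G ws = foldr (\<otimes>\<^bsub>G\<^esub>) ws \<one>\<^bsub>G\<^esub>"

text \<open>Meaningful only for elements of the subgroup generated by \<open>S\<close>.\<close>

definition word_length :: "('a, 'b) monoid_scheme \<Rightarrow> 'a set \<Rightarrow> 'a \<Rightarrow> nat" where
  "word_length G S g =
     (LEAST n. \<exists>ws. length ws = n \<and> set ws \<subseteq> S \<union> m_inv G ` S \<and> word_prod G ws = g)"

definition growth :: "('a, 'b) monoid_scheme \<Rightarrow> 'a set \<Rightarrow> nat \<Rightarrow> nat" where
  "growth G S n = card {g \<in> carrier G. word_length G S g \<le> n}"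

fun letter_mat :: "letter \<Rightarrow> complex mat" where
  "letter_mat L0 = mat_of_rows_list 3 [[2, 0, 1], [0, 2, 1], [0, 0, 1]]"
| "letter_mat L1 = mat_of_rows_list 3 [[2, 1, 0], [0, 1, 0], [0, 1, 2]]"
| "letter_mat L2 = mat_of_rows_list 3 [[1, 0, 0], [1, 2, 0], [1, 0, 2]]"

definition period_mat :: "(nat \<Rightarrow> letter) \<Rightarrow> nat \<Rightarrow> complex mat" where
  "period_mat \<omega> q = foldr (\<lambda>i A. letter_mat (\<omega> i) * A) [0..<q] (1\<^sub>m 3)"

lemma bij_child_tree_aut:
  assumes "f \<circ> f = id" "f [] = []" "\<And>u v. child u v \<Longrightarrow> child (f u) (f v)"
  shows "f \<in> carrier tree_aut"
proof -
  have ff: "f (f u) = u" for u using assms(1) by (metis comp_apply id_apply)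
  have "bij f" using assms(1) by (metis o_bij)
  moreover have "child u v \<longleftrightarrow> child (f u) (f v)" for u v
    using assms(3)[of u v] assms(3)[of "f u" "f v"] ff by auto
  ultimately show ?thesis using assms(2) by (auto simp: tree_aut_def)
qed

lemma child_Nil: "child [] v \<longleftrightarrow> (\<exists>i. v = [i])"
  by (auto simp: child_def)

lemma child_Cons: "child (i # u) v \<longleftrightarrow> (\<exists>v'. v = i # v' \<and> child u v')"
  by (auto simp: child_def)

lemma group_tree_aut: "group tree_aut"
proof (rule groupI)
  fix f assume f: "f \<in> carrier tree_aut"
  have bf: "bij f" and f0: "f [] = []" and cf: "\<And>u v. child u v \<longleftrightarrow> child (f u) (f v)"
    using f by (auto simp: tree_aut_def)
  have fi: "f (inv_into UNIV f u) = u" for u using bf by (simp add: bij_is_surj surj_f_inv_f)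
  have "inv_into UNIV f \<in> carrier tree_aut"
    using bij_imp_bij_inv[OF bf] inv_f_f[OF bij_is_inj[OF bf], of "[]"] f0
      cf[of "inv_into UNIV f _" "inv_into UNIV f _"]
    by (auto simp: tree_aut_def fi)
  moreover have "inv_into UNIV f \<otimes>\<^bsub>tree_aut\<^esub> f = \<one>\<^bsub>tree_aut\<^esub>"
    by (auto simp: tree_aut_def fi)
  ultimately show "\<exists>g\<in>carrier tree_aut. g \<otimes>\<^bsub>tree_aut\<^esub> f = \<one>\<^bsub>tree_aut\<^esub>" by blast
qed (auto simp: tree_aut_def bij_comp o_assoc)

lemma aut_a_simps [simp]: "aut_a [] = []" "aut_a (i # w) = (\<not> i) # w"
  by (auto simp: aut_a_def)

lemma aut_a_aut_a [simp]: "aut_a (aut_a w) = w"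
  by (cases w) auto

lemma aut_a_in_carrier: "aut_a \<in> carrier tree_aut"
proof (rule bij_child_tree_aut)
  show "child (aut_a u) (aut_a v)" if "child u v" for u v
    using that by (cases u) (auto simp: child_Nil child_Cons)
qed (auto simp: fun_eq_iff)

lemma letter_hom_simps [simp]: "letter_hom l x [] = []" "letter_hom l x (letter_hom l x w) = w"
  by (auto simp: letter_hom_def)

lemma id_in_tree_aut: "id \<in> carrier tree_aut"
  by (rule bij_child_tree_aut) auto

lemma letter_hom_in_carrier: "letter_hom l x \<in> carrier tree_aut"
  by (auto simp: letter_hom_def aut_a_in_carrier id_in_tree_aut)

lemma letter_hom_child: "child u v \<Longrightarrow> child (letter_hom l x u) (letter_hom l x v)"
  using letter_hom_in_carrier[of l x] by (auto simp: tree_aut_def)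

lemma directed_directed: "directed x \<omega> (directed x \<omega> w) = w"
  by (induction w arbitrary: \<omega>) auto

lemma directed_in_carrier: "directed x \<omega> \<in> carrier tree_aut"
proof (rule bij_child_tree_aut)
  show "child (directed x \<omega> u) (directed x \<omega> v)" if "child u v" for u v
    using that
    by (induction u arbitrary: v \<omega>) (auto simp: child_Nil child_Cons letter_hom_child)
qed (auto simp: fun_eq_iff directed_directed)

lemma directed_wreath: "directed x \<omega> = wreath (letter_hom (\<omega> 0) x) (directed x (shift \<omega>)) id"
proof
  show "directed x \<omega> w = wreath (letter_hom (\<omega> 0) x) (directed x (shift \<omega>)) id w" for w
    by (cases w) auto
qed

lemma grigorchuk_gens_carrier: "grigorchuk_gens \<omega> \<subseteq> carrier tree_aut"
  by (auto simp: grigorchuk_gens_def aut_a_in_carrier directed_in_carrier)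

lemma group_grigorchuk_group: "group (grigorchuk_group \<omega>)"
  unfolding grigorchuk_group_def by (rule group.group_subgroup_generated[OF group_tree_aut])

lemma carrier_grigorchuk_group:
  "carrier (grigorchuk_group \<omega>) = generate tree_aut (grigorchuk_gens \<omega>)"
  using grigorchuk_gens_carrier[of \<omega>]
  by (simp add: grigorchuk_group_def carrier_subgroup_generated Int_absorb1)

lemma aut_a_neq_id: "aut_a \<noteq> id"
  by (metis aut_a_simps(2) id_apply list.inject)

lemma klein_mult_simps [simp]:
  "klein_mult Kid x = x" "klein_mult x Kid = x" "klein_mult x x = Kid"
  "klein_mult Kb Kc = Kd" "klein_mult Kc Kb = Kd"
  "klein_mult Kb Kd = Kc" "klein_mult Kd Kb = Kc"
  "klein_mult Kc Kd = Kb" "klein_mult Kd Kc = Kb"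
  by (auto simp: klein_mult_def intro!: the_equality; metis klein.exhaust)+

lemma generate_aut_a: "generate tree_aut {aut_a} = {id, aut_a}"
proof -
  have inv_a: "inv\<^bsub>tree_aut\<^esub> aut_a = aut_a"
    by (rule group.inv_equality[OF group_tree_aut])
       (auto simp: aut_a_in_carrier, auto simp: tree_aut_def fun_eq_iff)
  have "x \<in> generate tree_aut {aut_a} \<Longrightarrow> x \<in> {id, aut_a}" for x
  proof (induction rule: generate.induct)
    case (eng h1 h2)
    then show ?case by (auto simp: tree_aut_def fun_eq_iff)
  qed (auto simp: inv_a, auto simp: tree_aut_def)
  moreover have "id \<in> generate tree_aut {aut_a}"
    using generate.one[of tree_aut] by (simp add: tree_aut_def)
  ultimately show ?thesis by (auto intro: generate.incl)
qed

lemma letter_hom_iff: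
  "(\<exists>l. f = letter_hom l) \<longleftrightarrow>
     f \<in> hom klein_four (subgroup_generated tree_aut {aut_a}) \<and> (\<exists>x. f x \<noteq> id)"
  (is "?L \<longleftrightarrow> ?R")
proof
  have C: "carrier (subgroup_generated tree_aut {aut_a}) = {id, aut_a}"
    by (simp add: carrier_subgroup_generated aut_a_in_carrier generate_aut_a)
  have M: "x \<otimes>\<^bsub>subgroup_generated tree_aut {aut_a}\<^esub> y = y \<circ> x" for x y
    by (simp add: subgroup_generated_def tree_aut_def)
  have H: "f \<in> hom klein_four (subgroup_generated tree_aut {aut_a}) \<longleftrightarrow>
      (\<forall>x. f x = id \<or> f x = aut_a) \<and> (\<forall>x y. f (klein_mult x y) = f y \<circ> f x)"
    unfolding hom_def C M by (auto simp: klein_four_def Pi_iff)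
  have aa: "aut_a \<circ> aut_a = id" by (auto simp: fun_eq_iff)
  {
    assume ?L
    then obtain l where f: "f = letter_hom l" by auto
    have "f (klein_mult x y) = f y \<circ> f x" for x y
      by (cases l; cases x; cases y) (auto simp: f letter_hom_def aa)
    moreover have "f (if l = L0 then Kb else Kd) \<noteq> id"
      by (cases l) (auto simp: f letter_hom_def aut_a_neq_id)
    moreover have "f x = id \<or> f x = aut_a" for x
      by (auto simp: f letter_hom_def)
    ultimately show ?R unfolding H by blast
  next
    assume ?R
    then have h: "f (klein_mult x y) = f y \<circ> f x" and r: "f x = id \<or> f x = aut_a" for x y
      unfolding H by blast+
    from \<open>?R\<close> obtain z where z: "f z \<noteq> id" by blast
    have e: "f Kid = id" using h[of Kb Kb] r[of Kb] aa by auto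
    have d: "f Kd = f Kc \<circ> f Kb" using h[of Kb Kc] by simp
    have ne: "f Kb \<noteq> id \<or> f Kc \<noteq> id"
      using z e d by (cases z) auto
    consider "f Kb = aut_a" "f Kc = aut_a" | "f Kb = aut_a" "f Kc = id"
      | "f Kb = id" "f Kc = aut_a"
      using ne r[of Kb] r[of Kc] by auto
    then show ?L
    proof cases
      case 1
      then have "f x = letter_hom L0 x" for x
        using e d aa by (cases x) (auto simp: letter_hom_def)
      then show ?thesis by blast
    next
      case 2
      then have "f x = letter_hom L1 x" for x
        using e d by (cases x) (auto simp: letter_hom_def)
      then show ?thesis by blast
    next
      case 3
      then have "f x = letter_hom L2 x" for x
        using e d by (cases x) (auto simp: letter_hom_def)
      then show ?thesis by blast
    qed
  }
qed

end

theory Submission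
  imports Defs
begin

text \<open>The proof compares the length of a word with the level of the tree at which its sections become bounded.
Let \<open>T_n\<close> be the sum of the entries of \<open>(1,1,1) M(\<omega> 0) \<dots> M(\<omega> (n-1))\<close>. It is shown that balls of radius comparable to
\<open>T_n\<close> contain \<open>exp\<close> of about \<open>2^n\<close> elements: more precisely, \<open>card_ball_le\<close> bounds the ball of radius \<open>T_n\<close> by
\<open>exp (C 2^n)\<close> for every \<open>n\<close>, and \<open>card_ball_ge\<close> gives at least \<open>2^(2^n)\<close> elements in the ball of radius \<open>K T_n\<close> for
all multiples \<open>n\<close> of some \<open>L\<close>. Since \<open>T_(j q)\<close> is the sum of the entries of the \<open>j\<close>-th power of the period
matrix, \<open>ln T_n / n\<close> tends to \<open>ln \<lambda> / q\<close>, and the growth exponent is \<open>ln 2\<close> divided by this limit.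

The matrices enter through the two sections of a word \<open>a x_1 a x_2 \<dots>\<close>. A letter \<open>x\<close> acts as itself on one child
of the root and as \<open>\<omega>_0(x)\<close> on the other. If \<open>\<omega>_0(x)\<close> is trivial, the two neighbours of that position are merged
into one letter. The matrix of \<open>\<omega>_0\<close> describes the case in which every such merge is of the form \<open>b c = d\<close> (up to
renaming), where \<open>\<omega>_0\<close> vanishes on \<open>d\<close>. All other merges shorten the sections at least as much, as measured by the weights
\<open>(1,1,1) M(\<omega> 0) \<dots> M(\<omega> (n-1))\<close>, which satisfy the triangle inequalities. Hence a word of length \<open>T_n\<close> has sections at level
\<open>n\<close> of total length at most a constant times \<open>2^n\<close>, and there are few such families of sections: this is the
upper bound.

For the lower bound the optimal case is realised by a substitution, \<open>inflate\<close>. Its \<open>n\<close>-fold iterate takes a word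
\<open>u\<close> to a word of length at most \<open>T_n\<close> times that of \<open>u\<close>, all of whose sections at level \<open>n\<close> are equal to \<open>u\<close> after a
change of coordinates. By induction along the multiples \<open>n\<close> of \<open>L\<close> one constructs, for a suitable element \<open>h\<close> and for every set of vertices of
level \<open>n\<close>, a word of length at most \<open>K T_n\<close> that acts as \<open>h\<close> below the vertices of the set and trivially below the
others. The step from \<open>n\<close> to \<open>n + L\<close> rests on the identity of \<open>seed_exists\<close>: there is a \<open>U\<close> such that the commutator of
\<open>h\<close> and \<open>U\<close> is a copy of \<open>h\<close> below \<open>1^L\<close>. Taking commutators with the inflation of \<open>U\<close> and conjugating by inflations of
elements that move \<open>1^L\<close> around, one obtains a copy of \<open>h\<close> below each of the \<open>2^L\<close> vertices at the price of two words of
the previous stage per vertex. Since \<open>T_(n+L) / T_n\<close> is at least \<open>2^(L+2)\<close> for suitable \<open>L\<close>, the lengths remain bounded by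
\<open>K T_n\<close>.\<close>

section \<open>Words over the Klein four-group\<close>

text \<open>Since \<open>a\<close> is an involution and \<open>b, c, d\<close> together with the identity form a group, every element
of \<open>G_\<omega>\<close> is a product \<open>a x_1 a x_2 \<dots> a x_m\<close>, and it is represented by the list of the \<open>x_i\<close>. With
\<open>Kid\<close> admitted as a letter, \<open>[Kid]\<close> is \<open>a\<close> and \<open>[Kid, x]\<close> is \<open>x\<close>, so every element is reached.\<close>

fun act :: "(nat \<Rightarrow> letter) \<Rightarrow> klein list \<Rightarrow> vertex \<Rightarrow> vertex" where
  "act \<omega> [] v = v"
| "act \<omega> (x # u) v = act \<omega> u (directed x \<omega> (aut_a v))"

lemma act_append: "act \<omega> (u @ u') v = act \<omega> u' (act \<omega> u v)"
  by (induction u arbitrary: v) auto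

lemma letter_hom_Kid [simp]: "letter_hom l Kid v = v"
  by (simp add: letter_hom_def)

lemma directed_Kid [simp]: "directed Kid \<omega> v = v"
  by (induction v arbitrary: \<omega>) auto

lemma letter_hom_mult: "letter_hom l y (letter_hom l x v) = letter_hom l (klein_mult x y) v"
  by (cases l; cases x; cases y) (auto simp: letter_hom_def)

lemma directed_mult: "directed y \<omega> (directed x \<omega> v) = directed (klein_mult x y) \<omega> v"
  by (induction v arbitrary: \<omega>) (auto simp: letter_hom_mult)

lemma directed_involution [simp]: "directed x \<omega> (directed x \<omega> v) = v"
  by (rule directed_directed)

lemma directed_mult_simps [simp]:
  "directed Kc \<omega> (directed Kb \<omega> v) = directed Kd \<omega> v" "directed Kb \<omega> (directed Kc \<omega> v) = directed Kd \<omega> v"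
  "directed Kd \<omega> (directed Kb \<omega> v) = directed Kc \<omega> v" "directed Kb \<omega> (directed Kd \<omega> v) = directed Kc \<omega> v"
  "directed Kd \<omega> (directed Kc \<omega> v) = directed Kb \<omega> v" "directed Kc \<omega> (directed Kd \<omega> v) = directed Kb \<omega> v"
  by (simp_all add: directed_mult)

definition inv_word :: "klein list \<Rightarrow> klein list" where
  "inv_word u = Kid # rev u @ [Kid]"

lemma act_inv_word [simp]: "act \<omega> (inv_word u) (act \<omega> u v) = v" "act \<omega> u (act \<omega> (inv_word u) v) = v"
proof -
  have shift_a: "aut_a (act \<omega> (rev u @ [Kid]) (aut_a v)) = act \<omega> (Kid # rev u) v" for u v
    by (simp add: act_append)
  have 1: "act \<omega> (rev u) (aut_a (act \<omega> u v)) = aut_a v" for u v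
    by (induction u arbitrary: v) (auto simp: act_append)
  show "act \<omega> (inv_word u) (act \<omega> u v) = v"
    by (simp add: inv_word_def act_append 1)
  have 2: "act \<omega> u (aut_a (act \<omega> (rev u) v)) = aut_a v" for u v
    by (induction u arbitrary: v rule: rev_induct) (auto simp: act_append)
  show "act \<omega> u (act \<omega> (inv_word u) v) = v"
    by (simp add: inv_word_def act_append 2)
qed

lemma length_inv_word [simp]: "length (inv_word u) = length u + 2"
  by (simp add: inv_word_def)

lemma act_inj: "act \<omega> u v = act \<omega> u v' \<longleftrightarrow> v = v'"
  by (metis act_inv_word(1))

lemma length_aut_a [simp]: "length (aut_a v) = length v"
  by (cases v) auto

lemma length_directed [simp]: "length (directed x \<omega> v) = length v"
  by (induction v arbitrary: \<omega>) (auto simp: letter_hom_def)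

lemma length_act [simp]: "length (act \<omega> u v) = length v"
  by (induction u arbitrary: v) auto

lemma act_root [simp]: "act \<omega> u [] = []"
  using length_act[of \<omega> u "[]"] by (simp del: length_act)

lemma aut_a_prefix: "\<exists>w'. length w' = length w \<and> aut_a (v @ w) = aut_a v @ w'"
  by (cases v) auto

lemma directed_prefix: "\<exists>w'. length w' = length w \<and> directed x \<omega> (v @ w) = directed x \<omega> v @ w'"
proof (induction v arbitrary: \<omega>)
  case (Cons i v)
  then show ?case using aut_a_prefix[of w v] by (auto simp: letter_hom_def)
qed auto

text \<open>The action on the infinite tails is carried along with the action on a vertex \<open>v\<close>: this is what makes
sections at \<open>v\<close> meaningful.\<close>

lemma act_prefix: "\<exists>w'. length w' = length w \<and> act \<omega> u (v @ w) = act \<omega> u v @ w'"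
proof (induction u arbitrary: v w)
  case (Cons x u)
  obtain w1 where w1: "length w1 = length w" "aut_a (v @ w) = aut_a v @ w1"
    using aut_a_prefix by blast
  obtain w2 where w2: "length w2 = length w1"
      "directed x \<omega> (aut_a v @ w1) = directed x \<omega> (aut_a v) @ w2"
    using directed_prefix by blast
  show ?case using Cons[of w2 "directed x \<omega> (aut_a v)"] w1 w2 by auto
qed auto

section \<open>Inflation: words with two equal sections\<close>

text \<open>The inflation turns a word over \<open>s\<omega>\<close> into a word over \<open>\<omega>\<close> that has the given word as both of its
sections. A letter \<open>x\<close> whose image under \<open>\<omega>_0\<close> is \<open>a\<close> is doubled: in \<open>a x a x\<close> each child sees \<open>x\<close> and
\<open>a\<close> once. The letter \<open>z\<close> on which \<open>\<omega>_0\<close> vanishes becomes \<open>a p a z a p'\<close> with \<open>p p' = z\<close>: one child sees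
\<open>p\<close> and \<open>p'\<close> with nothing in between, hence \<open>z\<close>, and the other one sees \<open>z\<close> itself between two \<open>a\<close>. No
letter is wasted, which is why the numbers of letters \<open>b, c, d\<close> are multiplied by the matrix of \<open>\<omega>_0\<close>.\<close>

definition partner :: "letter \<Rightarrow> klein" where
  "partner l = (if l = L2 then Kc else Kb)"

definition inflate_letter :: "letter \<Rightarrow> klein \<Rightarrow> klein list" where
  "inflate_letter l x =
     (if x = Kid then [Kid]
      else if x = vanishes_on l then [partner l, x, klein_mult x (partner l)]
      else [x, x])"

definition inflate :: "letter \<Rightarrow> klein list \<Rightarrow> klein list" where
  "inflate l u = concat (map (inflate_letter l) u)"

lemma inflate_simps [simp]: "inflate l [] = []" "inflate l (x # u) = inflate_letter l x @ inflate l u"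
  "inflate l (u @ u') = inflate l u @ inflate l u'"
  by (simp_all add: inflate_def)

text \<open>Whether the inflated word exchanges the two children: its number of factors \<open>a\<close> is odd exactly when the
letters that inflate to an odd number of letters occur an odd number of times.\<close>

definition swaps :: "letter \<Rightarrow> klein list \<Rightarrow> bool" where
  "swaps l u = odd (count_list u Kid + count_list u (vanishes_on l))"

definition cond_a :: "bool \<Rightarrow> vertex \<Rightarrow> vertex" where
  "cond_a i w = (if i then w else aut_a w)"

lemma cond_a_cond_a [simp]: "cond_a i (cond_a i w) = w"
  by (simp add: cond_a_def)

lemma length_cond_a [simp]: "length (cond_a i w) = length w"
  by (simp add: cond_a_def)

text \<open>The sections of the inflated word are \<open>u\<close> with a possible extra \<open>a\<close> at either end, depending on
whether the child entered, respectively left, is \<open>0\<close>. The extra \<open>a\<close> therefore depends on the position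
only, and a change of coordinates (\<open>twist\<close>, below) removes it.\<close>

lemma act_inflate:
  "act \<omega> (inflate (\<omega> 0) u) (i # w) =
     (let j = (i \<noteq> swaps (\<omega> 0) u) in j # cond_a j (act (shift \<omega>) u (cond_a i w)))"
proof (induction u arbitrary: i w)
  case Nil
  show ?case by (simp add: swaps_def)
next
  case (Cons x u)
  have 1: "act \<omega> (inflate_letter (\<omega> 0) x) (i # w) =
     (let j = (i \<noteq> swaps (\<omega> 0) [x]) in j # cond_a j (act (shift \<omega>) [x] (cond_a i w)))"
    by (cases i; cases "\<omega> 0"; cases x)
       (auto simp: inflate_letter_def swaps_def partner_def cond_a_def letter_hom_def)
  have 2: "swaps l (x # u) = (swaps l [x] \<noteq> swaps l u)" for l
    by (auto simp: swaps_def)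
  show ?case
    by (simp add: act_append 1 Cons Let_def 2[of "\<omega> 0"]) (auto simp: cond_a_def)
qed

text \<open>The tree automorphism that conjugates the \<open>n\<close>-fold inflation of \<open>u\<close> to a translation of level \<open>n\<close>
combined with \<open>u\<close> below every vertex of that level, see \<open>act_inflates\<close>.\<close>

fun twist :: "nat \<Rightarrow> vertex \<Rightarrow> vertex" where
  "twist (Suc n) (i # v) = i # cond_a i (twist n v)"
| "twist _ v = v"

fun inflates :: "nat \<Rightarrow> (nat \<Rightarrow> letter) \<Rightarrow> klein list \<Rightarrow> klein list" where
  "inflates 0 \<omega> u = u"
| "inflates (Suc n) \<omega> u = inflate (\<omega> 0) (inflates n (shift \<omega>) u)"

fun swap_vec :: "nat \<Rightarrow> (nat \<Rightarrow> letter) \<Rightarrow> klein list \<Rightarrow> bool list" where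
  "swap_vec 0 \<omega> u = []"
| "swap_vec (Suc n) \<omega> u = swaps (\<omega> 0) (inflates n (shift \<omega>) u) # swap_vec n (shift \<omega>) u"

definition xor_list :: "bool list \<Rightarrow> bool list \<Rightarrow> bool list" where
  "xor_list v s = map2 (\<noteq>) v s"

lemma xor_list_simps [simp]: "xor_list [] s = []" "xor_list (i # v) (j # s) = (i \<noteq> j) # xor_list v s"
  by (simp_all add: xor_list_def)

lemma length_swap_vec [simp]: "length (swap_vec n \<omega> u) = n"
  by (induction n arbitrary: \<omega>) auto

lemma length_xor_list [simp]: "length v = length s \<Longrightarrow> length (xor_list v s) = length s"
  by (simp add: xor_list_def)

lemma xor_list_xor_list [simp]: "length v = length s \<Longrightarrow> xor_list (xor_list v s) s = v"
  by (induction v s rule: list_induct2) auto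

lemma act_inflates:
  assumes "length v = n"
  shows "act \<omega> (inflates n \<omega> u) (twist n (v @ w)) =
         twist n (xor_list v (swap_vec n \<omega> u) @ act ((shift ^^ n) \<omega>) u w)"
  using assms
proof (induction n arbitrary: v \<omega>)
  case (Suc n)
  then obtain i v' where v: "v = i # v'" "length v' = n" by (cases v) auto
  have "(shift ^^ n) (shift \<omega>) = (shift ^^ Suc n) \<omega>"
    by (simp add: funpow_swap1)
  then show ?case using Suc.IH[OF v(2), of "shift \<omega>"]
    by (simp add: v act_inflate Let_def)
qed auto

lemma length_twist [simp]: "length (twist n v) = length v"
  by (induction n v rule: twist.induct) auto

lemma twist_inj: "twist n v = twist n v' \<longleftrightarrow> v = v'"
proof (induction n arbitrary: v v')
  case (Suc n)
  show ?case
  proof (cases v; cases v')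
    fix i u i' u' assume v: "v = i # u" "v' = i' # u'"
    have "cond_a i (twist n u) = cond_a i (twist n u') \<longleftrightarrow> u = u'"
      by (metis Suc cond_a_cond_a)
    then show ?thesis by (auto simp: v)
  qed auto
qed auto

lemma twist_surj: "\<exists>v'. length v' = length v \<and> twist n v' = v"
proof (induction n arbitrary: v)
  case (Suc n)
  show ?case
  proof (cases v)
    case (Cons i u)
    obtain v' where "length v' = length (cond_a i u)" "twist n v' = cond_a i u" using Suc by blast
    then show ?thesis by (intro exI[of _ "i # v'"]) (simp add: Cons)
  qed auto
qed auto

lemma twist_add:
  "length v = m \<Longrightarrow> twist (m + n) (v @ w) = twist m (v @ twist n w)"
  by (induction m arbitrary: v) (auto simp: length_Suc_conv)

text \<open>For words in which every letter, \<open>Kid\<close> included, occurs an even number of times the translation is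
trivial, at every depth; products of conjugates of commutators are of this kind.\<close>

definition even_word :: "klein list \<Rightarrow> bool" where
  "even_word u \<longleftrightarrow> (\<forall>x. even (count_list u x))"

lemma count_list_inflate:
  "count_list (inflate l u) y =
     (case y of Kid \<Rightarrow> count_list u Kid
      | _ \<Rightarrow> if y = vanishes_on l then count_list u y else 2 * count_list u y + count_list u (vanishes_on l))"
proof (induction u)
  case (Cons x u)
  then show ?case
    by (cases l; cases x; cases y) (auto simp: inflate_letter_def partner_def)
qed (auto split: klein.split)

lemma even_word_inflate: "even_word u \<Longrightarrow> even_word (inflate l u)"
  by (auto simp: even_word_def count_list_inflate split: klein.split)

lemma even_word_inflates: "even_word u \<Longrightarrow> even_word (inflates n \<omega> u)"
  by (induction n arbitrary: \<omega>) (auto simp: even_word_inflate)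

lemma swap_vec_even_word: "even_word u \<Longrightarrow> swap_vec n \<omega> u = replicate n False"
proof (induction n arbitrary: \<omega>)
  case (Suc n)
  have "even_word (inflates n (shift \<omega>) u)" using Suc.prems by (rule even_word_inflates)
  then show ?case using Suc by (auto simp: swaps_def even_word_def)
qed auto

lemma xor_list_zero [simp]: "xor_list v (replicate (length v) False) = v"
  by (induction v) auto

corollary act_inflates_even:
  assumes "length v = n" "even_word u"
  shows "act \<omega> (inflates n \<omega> u) (twist n (v @ w)) = twist n (v @ act ((shift ^^ n) \<omega>) u w)"
  using assms xor_list_zero[of v] by (simp add: act_inflates swap_vec_even_word)

section \<open>Elements supported below a single vertex\<close>

lemma partner_simps [simp]: "partner l \<noteq> Kid" "partner l \<noteq> vanishes_on l"
  by (cases l; simp add: partner_def)+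

lemma act_inv_word_append:
  "act \<omega> (inv_word (g @ h)) v = act \<omega> (inv_word g) (act \<omega> (inv_word h) v)"
proof -
  have "act \<omega> (g @ h) (act \<omega> (inv_word (g @ h)) v)
      = act \<omega> (g @ h) (act \<omega> (inv_word g) (act \<omega> (inv_word h) v))"
    by (simp only: act_inv_word) (simp add: act_append)
  then show ?thesis by (simp only: act_inj)
qed

text \<open>The stabiliser of a vertex of the first level induces all of \<open>G_s\<omega>\<close> below it, and in the coordinates of
\<open>twist\<close> the vertex can be moved to \<open>1\<close> at the same time.\<close>

lemma section_onto:
  "\<exists>g'. \<forall>w. act \<omega> g' (i # cond_a i w) = True # act (shift \<omega>) g w"
proof -
  define j where "j = (i \<noteq> swaps (\<omega> 0) g)"
  have 1: "act \<omega> (inflate (\<omega> 0) g) (i # cond_a i w) = j # cond_a j (act (shift \<omega>) g w)" for w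
    by (simp add: act_inflate Let_def j_def)
  \<comment> \<open>the element \<open>x a\<close> with \<open>\<omega>_0(x) = a\<close> takes \<open>0\<close> to \<open>1\<close> and cancels the \<open>a\<close> left over below \<open>0\<close>\<close>
  have 2: "act \<omega> [Kid, partner (\<omega> 0), Kid] (False # aut_a w) = True # w" for w
    by (simp add: letter_hom_def)
  have "act \<omega> (inflate (\<omega> 0) g @ (if j then [] else [Kid, partner (\<omega> 0), Kid])) (i # cond_a i w)
      = True # act (shift \<omega>) g w" for w
  proof (cases j)
    case True
    then show ?thesis using 1[of w] by (simp add: cond_a_def[of True])
  next
    case False
    then have "act \<omega> (inflate (\<omega> 0) g) (i # cond_a i w) = False # aut_a (act (shift \<omega>) g w)"
      using 1[of w] by (simp add: cond_a_def[of False])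
    then show ?thesis unfolding act_append using False 2 by simp
  qed
  then show ?thesis by blast
qed

text \<open>Not only is the action on each level transitive; an element taking \<open>p\<close> to \<open>1^n\<close> can be chosen to carry
the subtree below \<open>p\<close> rigidly, so that conjugation by it moves a copy of an automorphism from \<open>1^n\<close> to \<open>p\<close>
unchanged.\<close>

lemma transitive_with_trivial_section:
  "length p = n \<Longrightarrow> \<exists>g. \<forall>w. act \<omega> g (twist n (p @ w)) = replicate n True @ w"
proof (induction n arbitrary: p \<omega>)
  case 0
  then show ?case by (intro exI[of _ "[]"]) auto
next
  case (Suc n)
  then obtain i p' where p: "p = i # p'" "length p' = n" by (cases p) auto
  obtain g where g: "\<And>w. act (shift \<omega>) g (twist n (p' @ w)) = replicate n True @ w"
    using Suc.IH[OF p(2)] by blast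
  obtain g' where "\<And>w. act \<omega> g' (i # cond_a i w) = True # act (shift \<omega>) g w"
    using section_onto by blast
  then have "act \<omega> g' (twist (Suc n) (p @ w)) = replicate (Suc n) True @ w" for w
    by (simp add: g p)
  then show ?case by blast
qed

text \<open>The conjugate of the commutator \<open>[a, x] = a x a x\<close> by \<open>g\<close>.\<close>

definition conj_comm :: "klein list \<Rightarrow> klein \<Rightarrow> klein list" where
  "conj_comm g x = inv_word g @ [x, x] @ g"

text \<open>Words for the elements of the normal closure of \<open>[a, x]\<close>.\<close>

inductive_set comm_words :: "klein \<Rightarrow> klein list set" for x where
  Nil: "[] \<in> comm_words x"
| step: "u \<in> comm_words x \<Longrightarrow> conj_comm g x @ u \<in> comm_words x"

lemma even_word_comm_words: "u \<in> comm_words x \<Longrightarrow> even_word u"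
proof (induction rule: comm_words.induct)
  case Nil
  then show ?case by (simp add: even_word_def)
next
  case (step u g)
  have "count_list (rev g) y = count_list g y" for y
    by (induction g) auto
  then show ?case using step by (auto simp: even_word_def conj_comm_def inv_word_def)
qed

text \<open>Let \<open>z\<close> be the letter on which \<open>\<omega>_0\<close> vanishes, so that \<open>z\<close> acts below \<open>1\<close> only. If \<open>\<omega>_0(y) = a\<close>, then
\<open>a y a\<close> has section \<open>a\<close> at \<open>1\<close>, and so \<open>(a y a) z (a y a) z\<close> is \<open>[a, z]\<close> below \<open>1\<close> and trivial elsewhere.
With \<open>a y a = [a, y] y\<close> it becomes \<open>[a, y]\<close> times its conjugate by \<open>y z\<close>. Writing the same element in terms
of \<open>a z a = [a, z] z\<close> instead exhibits it as a product of two conjugates of \<open>[a, z]\<close>.\<close>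

lemma comm_below_root:
  assumes "y \<noteq> Kid"
  shows "\<exists>g1 g2. \<forall>v. act \<omega> (conj_comm g1 y @ conj_comm g2 y) v =
     wreath id (act (shift \<omega>) [vanishes_on (\<omega> 0), vanishes_on (\<omega> 0)]) id v"
proof (cases "y = vanishes_on (\<omega> 0)")
  case True
  have "act \<omega> (conj_comm [Kid, partner (\<omega> 0), Kid] y @ conj_comm [Kid, y, Kid] y) v =
     wreath id (act (shift \<omega>) [vanishes_on (\<omega> 0), vanishes_on (\<omega> 0)]) id v" for v
  proof (cases v)
    case (Cons i w)
    show ?thesis unfolding Cons True
      by (cases "\<omega> 0"; cases i) (simp_all add: conj_comm_def inv_word_def letter_hom_def partner_def)
  qed (simp only: act_root wreath.simps)
  then show ?thesis by blast
next
  case False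
  have "act \<omega> (conj_comm [] y @ conj_comm [Kid, klein_mult y (vanishes_on (\<omega> 0))] y) v =
     wreath id (act (shift \<omega>) [vanishes_on (\<omega> 0), vanishes_on (\<omega> 0)]) id v" for v
  proof (cases v)
    case (Cons i w)
    show ?thesis unfolding Cons using False assms
      by (cases "\<omega> 0"; cases i; cases y) (simp_all add: conj_comm_def inv_word_def letter_hom_def)
  qed (simp only: act_root wreath.simps)
  then show ?thesis by blast
qed

text \<open>Conjugation by lifts of elements of \<open>G_s\<omega>\<close> extends the previous lemma to the whole normal closure.\<close>

lemma comm_words_below_root:
  assumes "u \<in> comm_words (vanishes_on (\<omega> 0))" "y \<noteq> Kid"
  shows "\<exists>u'\<in>comm_words y. \<forall>v. act \<omega> u' v = wreath id (act (shift \<omega>) u) id v"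
  using assms(1)
proof (induction rule: comm_words.induct)
  case Nil
  have "act \<omega> [] v = wreath id (act (shift \<omega>) []) id v" for v by (cases v) auto
  then show ?case using comm_words.Nil by blast
next
  case (step u g)
  let ?z = "vanishes_on (\<omega> 0)"
  obtain u' where u': "u' \<in> comm_words y" "\<And>v. act \<omega> u' v = wreath id (act (shift \<omega>) u) id v"
    using step.IH by blast
  obtain g1 g2 where g12: "\<And>v. act \<omega> (conj_comm g1 y @ conj_comm g2 y) v =
     wreath id (act (shift \<omega>) [?z, ?z]) id v"
    using comm_below_root[OF assms(2)] by blast
  obtain g' where "\<And>w. act \<omega> g' (True # cond_a True w) = True # act (shift \<omega>) g w"
    using section_onto by blast
  then have g': "act \<omega> g' (True # w) = True # act (shift \<omega>) g w" for w
    by (simp add: cond_a_def)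
  have g'_inv: "act \<omega> (inv_word g') (True # w) = True # act (shift \<omega>) (inv_word g) w" for w
    using g'[of "act (shift \<omega>) (inv_word g) w"] by (metis act_inv_word)
  have g'_False: "\<exists>w'. act \<omega> (inv_word g') (False # w) = False # w'" for w
  proof (cases "act \<omega> (inv_word g') (False # w)")
    case Nil
    then show ?thesis using length_act[of \<omega> "inv_word g'" "False # w"] by simp
  next
    case (Cons i w')
    have "i = False"
    proof (rule ccontr)
      assume "i \<noteq> False"
      then have "act \<omega> g' (True # w') = False # w" using Cons by (metis act_inv_word(2))
      then show False by (simp add: g')
    qed
    then show ?thesis using Cons by blast
  qed
  define u'' where "u'' = conj_comm (g1 @ g') y @ conj_comm (g2 @ g') y @ u'"
  have "act \<omega> u'' v = wreath id (act (shift \<omega>) (conj_comm g ?z @ u)) id v" for v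
  proof -
    have "act \<omega> u'' v = act \<omega> u' (act \<omega> g' (act \<omega> (conj_comm g1 y @ conj_comm g2 y)
        (act \<omega> (inv_word g') v)))"
      unfolding u''_def conj_comm_def by (simp only: act_append act_inv_word act_inv_word_append)
    also have "\<dots> = wreath id (act (shift \<omega>) (conj_comm g ?z @ u)) id v"
    proof (cases v)
      case Nil
      show ?thesis by (simp add: Nil del: act.simps)
    next
      case (Cons i w)
      show ?thesis
      proof (cases i)
        case True
        then have v: "v = True # w" using Cons by simp
        show ?thesis unfolding g12 u' v
          by (simp add: g'_inv g' conj_comm_def act_append)
      next
        case False
        obtain w' where w': "act \<omega> (inv_word g') (False # w) = False # w'" using g'_False by blast
        have v: "v = False # w" using Cons False by simp
        have w'g: "act \<omega> g' (False # w') = False # w" using w' by (metis act_inv_word(2))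
        have stay: "wreath id f id (False # w) = False # w" for f w by simp
        show ?thesis unfolding g12 u' v w' stay w'g ..
      qed
    qed
    finally show ?thesis .
  qed
  moreover have "u'' \<in> comm_words y"
    unfolding u''_def by (intro comm_words.step u')
  ultimately show ?case by blast
qed

fun below :: "nat \<Rightarrow> (vertex \<Rightarrow> vertex) \<Rightarrow> vertex \<Rightarrow> vertex" where
  "below 0 f v = f v"
| "below (Suc n) f v = wreath id (below n f) id v"

lemma below_inside [simp]: "below n f (replicate n True @ w) = replicate n True @ f w"
  by (induction n) auto

lemma below_outside: "(\<nexists>w. v = replicate n True @ w) \<Longrightarrow> below n f v = v"
proof (induction n arbitrary: v)
  case (Suc n)
  show ?case
  proof (cases v)
    case (Cons i w)
    then show ?thesis using Suc by (cases i) auto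
  qed auto
qed auto

text \<open>The conclusion of the one-step statement holds for every letter \<open>y\<close>, in particular for the one that
the next step upwards requires; this is what makes the iteration to arbitrary depth possible.\<close>

lemma comm_words_below:
  assumes "u \<in> comm_words (vanishes_on (\<omega> n))" "y \<noteq> Kid"
  shows "\<exists>u'\<in>comm_words y. \<forall>v. act \<omega> u' v = below (Suc n) (act ((shift ^^ Suc n) \<omega>) u) v"
  using assms
proof (induction n arbitrary: \<omega> y)
  case 0
  have "below 0 f = f" for f by (simp add: fun_eq_iff)
  then show ?case using comm_words_below_root[where \<omega> = \<omega>, of u y] 0 by simp
next
  case (Suc n)
  have "vanishes_on (\<omega> 0) \<noteq> Kid" by (cases "\<omega> 0") auto
  moreover have "u \<in> comm_words (vanishes_on (shift \<omega> n))" using Suc.prems(1) by (simp add: shift_def)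
  ultimately obtain u1 where u1: "u1 \<in> comm_words (vanishes_on (\<omega> 0))"
      "\<And>v. act (shift \<omega>) u1 v = below (Suc n) (act ((shift ^^ Suc n) (shift \<omega>)) u) v"
    using Suc.IH by metis
  have e: "(shift ^^ Suc n) (shift \<omega>) = (shift ^^ Suc (Suc n)) \<omega>"
    by (simp add: funpow_swap1)
  obtain u2 where u2: "u2 \<in> comm_words y" "\<And>v. act \<omega> u2 v = wreath id (act (shift \<omega>) u1) id v"
    using comm_words_below_root[where \<omega> = \<omega>, OF u1(1) Suc.prems(2)] by blast
  have "act (shift \<omega>) u1 = below (Suc n) (act ((shift ^^ Suc (Suc n)) \<omega>) u)"
    using u1(2) unfolding e by blast
  then have "act \<omega> u2 v = below (Suc (Suc n)) (act ((shift ^^ Suc (Suc n)) \<omega>) u) v" for v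
    unfolding u2(2) by (simp del: funpow.simps)
  then show ?case using u2(1) by blast
qed

lemma shift_pow: "(shift ^^ n) \<omega> k = \<omega> (n + k)"
  by (induction n arbitrary: k) (auto simp: shift_def)

lemma directed_ones: "directed x \<omega> (replicate n True @ v) = replicate n True @ directed x ((shift ^^ n) \<omega>) v"
  by (induction n arbitrary: \<omega>) (auto simp: funpow_swap1)

lemma directed_fixes: "directed (vanishes_on (\<omega> t)) \<omega> (replicate t True @ False # w) = replicate t True @ False # w"
  by (simp add: directed_ones shift_pow letter_hom_def)

lemma periodic_mult:
  fixes \<omega> :: "nat \<Rightarrow> letter"
  assumes "\<And>n. \<omega> (n + q) = \<omega> n"
  shows "\<omega> (n + m * q) = \<omega> n"
proof (induction m)
  case (Suc m)
  have "\<omega> (n + Suc m * q) = \<omega> (n + m * q + q)" by (simp add: algebra_simps)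
  then show ?case using assms Suc by simp
qed simp

lemma directed_moves:
  assumes "x \<noteq> Kid" "range \<omega> = {L0, L1, L2}" "\<And>n. \<omega> (n + q) = \<omega> n" "q \<ge> 1" "L \<ge> q + 1"
  shows "\<exists>w. length w = L \<and> directed x \<omega> w \<noteq> w"
proof -
  note per = periodic_mult[where \<omega> = \<omega> and q = q, OF assms(3)]
  have "L0 \<in> range \<omega>" "L1 \<in> range \<omega>" using assms(2) by auto
  then obtain k where k: "x \<noteq> vanishes_on (\<omega> k)" by (metis imageE klein.distinct(11) vanishes_on.simps)
  define t where "t = k mod q"
  have t: "x \<noteq> vanishes_on (\<omega> t)" "t < q"
    using k per[of "k mod q" "k div q"] assms(4) by (auto simp: t_def)
  define w where "w = replicate t True @ False # replicate (L - t - 1) False"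
  have "directed x \<omega> w = replicate t True @ False # aut_a (replicate (L - t - 1) False)"
    using t assms(1) by (simp add: w_def directed_ones shift_pow letter_hom_def)
  moreover have "aut_a (replicate (L - t - 1) False) \<noteq> replicate (L - t - 1) False"
    using t(2) assms(5) by (cases "L - t - 1") auto
  ultimately have "directed x \<omega> w \<noteq> w" by (simp add: w_def)
  moreover have "length w = L" using t(2) assms(5) by (simp add: w_def)
  ultimately show ?thesis by blast
qed

lemma not_ones: "length v = L \<Longrightarrow> v \<noteq> replicate L True \<Longrightarrow> \<exists>t w. t < L \<and> v = replicate t True @ False # w"
proof (induction L arbitrary: v)
  case (Suc L)
  then obtain i v' where v: "v = i # v'" "length v' = L" by (cases v) auto
  show ?case
  proof (cases i)
    case True
    then obtain t w where "t < L" "v' = replicate t True @ False # w"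
      using Suc.IH[of v'] Suc.prems v by auto
    then show ?thesis using True v by (intro exI[of _ "Suc t"]) auto
  next
    case False
    then show ?thesis using v by (intro exI[of _ 0]) auto
  qed
qed auto

text \<open>If the section of \<open>x\<close> at \<open>0\<close> is \<open>a\<close>, already \<open>1^L\<close> is moved. Otherwise this section is trivial, whereas the
section at \<open>1\<close> is not, so that \<open>x\<close> does not commute with the exchange of the two subtrees.\<close>

lemma comm_moves:
  assumes "x \<noteq> Kid" "range \<omega> = {L0, L1, L2}" "\<And>n. \<omega> (n + q) = \<omega> n" "q \<ge> 1" "L \<ge> q + 2"
  shows "\<exists>r. length r = L \<and> act \<omega> [x, x] r \<noteq> r"
proof (cases "x = vanishes_on (\<omega> 0)")
  case False
  obtain m where L: "L = Suc (Suc m)" using assms(4,5) by (cases L; cases "L - 1") auto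
  have "act \<omega> [x, x] (replicate L True) \<noteq> replicate L True"
    using False assms(1) by (auto simp: L letter_hom_def)
  then show ?thesis by (intro exI[of _ "replicate L True"]) simp
next
  case True
  have "range (shift \<omega>) = range \<omega>"
  proof
    show "range \<omega> \<subseteq> range (shift \<omega>)"
    proof
      fix l assume "l \<in> range \<omega>"
      then obtain k where "l = \<omega> k" by blast
      then have "l = shift \<omega> (k + q - 1)" using assms(3)[of k] assms(4) by (simp add: shift_def)
      then show "l \<in> range (shift \<omega>)" by blast
    qed
  qed (auto simp: shift_def)
  moreover have "shift \<omega> (n + q) = shift \<omega> n" for n
    using assms(3)[of "Suc n"] by (simp add: shift_def)
  ultimately obtain r where r: "length r = L - 1" "directed x (shift \<omega>) r \<noteq> r"
    using directed_moves[of x "shift \<omega>" q "L - 1"] assms by (metis Suc_1 add_Suc_right diff_le_mono diff_add_inverse2 plus_1_eq_Suc add.commute)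
  have "act \<omega> [x, x] (False # r) = False # directed x (shift \<omega>) r"
    using True by (simp add: letter_hom_def)
  then show ?thesis using r assms(5) by (intro exI[of _ "False # r"]) auto
qed

lemma act_inv_eqI: "act \<omega> u v = v' \<Longrightarrow> act \<omega> (inv_word u) v' = v"
  using act_inv_word(1) by blast

lemma shift_pow_periodic:
  assumes "\<And>n. \<omega> (n + q) = \<omega> n" "q dvd L"
  shows "(shift ^^ L) \<omega> = \<omega>"
proof -
  show ?thesis using periodic_mult[where \<omega> = \<omega> and q = q, OF assms(1)] assms(2) by (auto simp: fun_eq_iff shift_pow dvd_def algebra_simps)
qed

text \<open>Choose \<open>k\<close> in the normal closure of \<open>[a, e]\<close>, where \<open>\<omega>_(L-1)\<close> vanishes on \<open>e\<close>, so that some \<open>U\<close> in the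
group acts as \<open>k\<close> below \<open>1^L\<close> and trivially elsewhere, and so that \<open>k\<close> moves \<open>1^L\<close>. The image of \<open>1^L\<close> begins
with \<open>1^t 0\<close> for some \<open>t\<close>, and the letter \<open>x\<close> on which \<open>\<omega>_t\<close> vanishes acts trivially below \<open>1^t 0\<close>. Hence
the commutator \<open>h\<close> of \<open>x\<close> and \<open>k\<close> fixes \<open>1^L\<close> and has section \<open>x\<close> there, so the commutator of \<open>h\<close> and \<open>U\<close>
is the commutator of \<open>x\<close> and \<open>k\<close> placed below \<open>1^L\<close>: a copy of \<open>h\<close> itself. A copy of \<open>h\<close> at depth \<open>L\<close> thus
costs two copies of \<open>h\<close> at depth \<open>0\<close>, however large \<open>L\<close> is.\<close>

lemma seed_exists:
  assumes full: "range \<omega> = {L0, L1, L2}" and per: "\<And>n. \<omega> (n + q) = \<omega> n"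
    and q: "q \<ge> 1" and L: "q dvd L" "L \<ge> q + 2"
  shows "\<exists>h U. even_word U \<and> (\<exists>w. act \<omega> h w \<noteq> w) \<and>
    (\<forall>v. act \<omega> h (act \<omega> (inv_word U) (act \<omega> (inv_word h) (act \<omega> U v))) = below L (act \<omega> h) v)"
proof -
  have sL: "(shift ^^ L) \<omega> = \<omega>" using shift_pow_periodic[of \<omega> q L] per L by blast
  define e where "e = vanishes_on (\<omega> (L - 1))"
  have e: "e \<noteq> Kid" by (cases "\<omega> (L - 1)") (auto simp: e_def)
  let ?o = "replicate L True"
  obtain r where r: "length r = L" "act \<omega> [e, e] r \<noteq> r"
    using comm_moves[of e \<omega> q L] e full per q L by blast
  obtain p where p: "length p = L" "twist L p = r" using twist_surj[of r L] r by auto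
  obtain g where "\<And>w. act \<omega> g (twist L (p @ w)) = ?o @ w"
    using transitive_with_trivial_section[OF p(1)] by blast
  from this[of "[]"] have g: "act \<omega> g r = ?o" using p by simp
  define k where "k = conj_comm g e"
  have kc: "k \<in> comm_words e" using comm_words.step[OF comm_words.Nil, of g e] by (simp add: k_def)
  have "act \<omega> k ?o = act \<omega> g (act \<omega> [e, e] r)"
    unfolding k_def conj_comm_def act_append g[symmetric] by (simp del: act.simps)
  then have "act \<omega> k ?o \<noteq> ?o" using r(2) g act_inj by metis
  then obtain t y where ty: "t < L" "act \<omega> k ?o = replicate t True @ False # y"
    using not_ones[of "act \<omega> k ?o" L] by auto
  obtain U where U: "U \<in> comm_words Kb" "\<And>v. act \<omega> U v = below L (act \<omega> k) v"
  proof -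
    have "Suc (L - 1) = L" using L by simp
    moreover have "\<exists>u'\<in>comm_words Kb. \<forall>v. act \<omega> u' v =
        below (Suc (L - 1)) (act ((shift ^^ Suc (L - 1)) \<omega>) k) v"
      by (rule comm_words_below) (use kc in \<open>auto simp: e_def\<close>)
    ultimately show thesis using that sL by metis
  qed
  define x where "x = vanishes_on (\<omega> t)"
  have x: "x \<noteq> Kid" by (cases "\<omega> t") (auto simp: x_def)
  define h where "h = k @ [Kid, x] @ inv_word k @ [Kid, x]"
  have act_x: "act \<omega> [Kid, x] v = directed x \<omega> v" for v by simp
  have h: "act \<omega> h v = directed x \<omega> (act \<omega> (inv_word k) (directed x \<omega> (act \<omega> k v)))" for v
    unfolding h_def act_append act_x ..
  have h_o: "act \<omega> h (?o @ w) = ?o @ directed x \<omega> w" for w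
  proof -
    obtain w' where w': "act \<omega> k (?o @ w) = act \<omega> k ?o @ w'" using act_prefix by blast
    then have "directed x \<omega> (act \<omega> k (?o @ w)) = act \<omega> k (?o @ w)"
      using directed_fixes[of \<omega> t "y @ w'"] by (simp add: ty x_def)
    then show ?thesis by (simp add: h directed_ones sL)
  qed
  have hi_o: "act \<omega> (inv_word h) (?o @ w) = ?o @ directed x \<omega> w" for w
    by (rule act_inv_eqI) (simp add: h_o)
  have Ui_o: "act \<omega> (inv_word U) (?o @ w) = ?o @ act \<omega> (inv_word k) w" for w
    by (rule act_inv_eqI) (simp add: U(2))
  have "act \<omega> h (act \<omega> (inv_word U) (act \<omega> (inv_word h) (act \<omega> U v))) = below L (act \<omega> h) v" for v
  proof (cases "\<exists>w. v = ?o @ w")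
    case True
    then obtain w where "v = ?o @ w" by blast
    then show ?thesis by (simp only: U(2) below_inside hi_o Ui_o h_o h[of w])
  next
    case False
    let ?v = "act \<omega> (inv_word h) v"
    have "\<nexists>w. ?v = ?o @ w"
    proof
      assume "\<exists>w. ?v = ?o @ w"
      then show False using False h_o by (metis act_inv_word(2))
    qed
    then have "act \<omega> (inv_word U) ?v = ?v"
      using U(2)[of ?v] below_outside[of ?v L] by (metis act_inv_word(1))
    then show ?thesis using False by (simp add: U(2) below_outside)
  qed
  moreover have "\<exists>w. act \<omega> h w \<noteq> w"
  proof -
    obtain w where "directed x \<omega> w \<noteq> w"
      using directed_moves[of x \<omega> q "q + 1"] x full per q by blast
    then have "act \<omega> h (?o @ w) \<noteq> ?o @ w" by (simp add: h_o)
    then show ?thesis by blast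
  qed
  ultimately show ?thesis using even_word_comm_words[OF U(1)] by blast
qed

section \<open>Independent lamps on a level\<close>

text \<open>A lamp is a copy of \<open>h\<close> below one vertex: in the coordinates of \<open>twist\<close>, the word \<open>u\<close>
acts as \<open>h\<close> below the vertices \<open>v\<close> of level \<open>n\<close> with \<open>\<phi> v\<close>,
and trivially below the others.\<close>

definition lamps :: "(nat \<Rightarrow> letter) \<Rightarrow> klein list \<Rightarrow> nat \<Rightarrow> (vertex \<Rightarrow> bool) \<Rightarrow> klein list \<Rightarrow> bool" where
  "lamps \<omega> h n \<phi> u \<longleftrightarrow> (\<forall>v w. length v = n \<longrightarrow>
     act \<omega> u (twist n (v @ w)) = twist n (v @ (if \<phi> v then act \<omega> h w else w)))"

lemma lampsD: "lamps \<omega> h n \<phi> u \<Longrightarrow> length v = n \<Longrightarrow>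
     act \<omega> u (twist n (v @ w)) = twist n (v @ (if \<phi> v then act \<omega> h w else w))"
  by (simp add: lamps_def)

lemma lamps_append:
  assumes "lamps \<omega> h n \<phi> u" "lamps \<omega> h n \<psi> u'" "\<And>v. \<not> (\<phi> v \<and> \<psi> v)"
  shows "lamps \<omega> h n (\<lambda>v. \<phi> v \<or> \<psi> v) (u @ u')"
  unfolding lamps_def
proof (intro allI impI)
  fix v w :: vertex assume v: "length v = n"
  show "act \<omega> (u @ u') (twist n (v @ w)) = twist n (v @ (if \<phi> v \<or> \<psi> v then act \<omega> h w else w))"
    unfolding act_append lampsD[OF assms(1) v] lampsD[OF assms(2) v] using assms(3)[of v] by simp
qed

lemma lamps_inv:
  assumes "lamps \<omega> h n \<phi> u" "length v = n"
  shows "act \<omega> (inv_word u) (twist n (v @ w)) =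
         twist n (v @ (if \<phi> v then act \<omega> (inv_word h) w else w))" (is "_ = twist n (v @ ?w)")
proof -
  have "act \<omega> u (twist n (v @ ?w)) = twist n (v @ w)"
    unfolding lampsD[OF assms] by simp
  then show ?thesis using act_inv_word(1)[of \<omega> u "twist n (v @ ?w)"] by simp
qed

text \<open>The commutator of a lamp word \<open>f\<close> and the inflation \<open>\<kappa>\<close> of \<open>U\<close> is computed below each vertex of level
\<open>n\<close> separately: it is trivial where the lamp of \<open>f\<close> is off, and a copy of \<open>h\<close> at \<open>1^L\<close> where it is on.
Conjugation by the inflation \<open>\<gamma>\<close> of \<open>g\<close> moves that copy to \<open>p\<close>. It also translates level \<open>n\<close> by the vector
\<open>s\<close>, for which the choice of the lamps of \<open>f\<close> compensates.\<close>

lemma lamps_at: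
  assumes per: "(shift ^^ n) \<omega> = \<omega>"
    and U: "even_word U"
    and h: "\<And>v. act \<omega> h (act \<omega> (inv_word U) (act \<omega> (inv_word h) (act \<omega> U v))) = below L (act \<omega> h) v"
    and p: "length p = L"
    and g: "\<And>w. act \<omega> g (twist L (p @ w)) = replicate L True @ w"
    and f: "\<And>\<phi>. \<exists>f. length f \<le> l \<and> lamps \<omega> h n \<phi> f"
  shows "\<exists>u. length u \<le> 2 * l + 2 * length (inflates n \<omega> g) + 2 * length (inflates n \<omega> U) + 6 \<and>
     lamps \<omega> h (n + L) (\<lambda>v. drop n v = p \<and> \<phi> v) u"
proof -
  define s where "s = swap_vec n \<omega> g"
  define \<gamma> where "\<gamma> = inflates n \<omega> g"
  define \<kappa> where "\<kappa> = inflates n \<omega> U"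
  obtain f where f: "length f \<le> l" "lamps \<omega> h n (\<lambda>v. \<phi> (xor_list v s @ p)) f"
    using f[of "\<lambda>v. \<phi> (xor_list v s @ p)"] by blast
  define u where "u = \<gamma> @ \<kappa> @ inv_word f @ inv_word \<kappa> @ f @ inv_word \<gamma>"
  have len: "length u \<le> 2 * l + 2 * length \<gamma> + 2 * length \<kappa> + 6"
    using f(1) by (simp add: u_def)
  have \<gamma>: "act \<omega> \<gamma> (twist n (v @ y)) = twist n (xor_list v s @ act \<omega> g y)" if "length v = n" for v y
    using act_inflates[OF that, of \<omega> g y] by (simp add: \<gamma>_def s_def per)
  have \<kappa>: "act \<omega> \<kappa> (twist n (v @ y)) = twist n (v @ act \<omega> U y)" if "length v = n" for v y
    using act_inflates_even[OF that U, of \<omega> y] by (simp add: \<kappa>_def per)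
  have \<kappa>i: "act \<omega> (inv_word \<kappa>) (twist n (v @ y)) = twist n (v @ act \<omega> (inv_word U) y)"
    if "length v = n" for v y
    by (rule act_inv_eqI) (simp add: \<kappa>[OF that])
  have ls: "length s = n" by (simp add: s_def)
  have "act \<omega> u (twist (n + L) (v @ w)) =
      twist (n + L) (v @ (if drop n v = p \<and> \<phi> v then act \<omega> h w else w))"
    if v: "length v = n + L" for v w
  proof -
    define v1 where "v1 = take n v"
    define v2 where "v2 = drop n v"
    have v12: "v = v1 @ v2" "length v1 = n" "length v2 = L" using v by (auto simp: v1_def v2_def)
    let ?y = "twist L (v2 @ w)"
    let ?x = "xor_list v1 s"
    have lx: "length ?x = n" using ls v12 by simp
    let ?c = "\<phi> (v1 @ p)"
    have "xor_list ?x s = v1" using ls v12 by simp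
    then have 1: "act \<omega> (\<kappa> @ inv_word f @ inv_word \<kappa> @ f) (twist n (?x @ y)) =
        twist n (?x @ (if ?c then below L (act \<omega> h) y else y))" for y
      unfolding act_append \<kappa>[OF lx] lamps_inv[OF f(2) lx] \<kappa>i[OF lx] lampsD[OF f(2) lx]
      by (simp add: h)
    have \<gamma>i: "act \<omega> (inv_word \<gamma>) (twist n (?x @ act \<omega> g y)) = twist n (v1 @ y)" for y
      by (rule act_inv_eqI) (rule \<gamma>[OF v12(2)])
    have "act \<omega> u (twist (n + L) (v @ w)) =
        act \<omega> (inv_word \<gamma>) (act \<omega> (\<kappa> @ inv_word f @ inv_word \<kappa> @ f) (act \<omega> \<gamma> (twist n (v1 @ ?y))))"
      unfolding v12(1) append_assoc twist_add[OF v12(2)] by (simp add: u_def act_append)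
    also have "\<dots> = act \<omega> (inv_word \<gamma>) (twist n (?x @ (if ?c then below L (act \<omega> h) (act \<omega> g ?y) else act \<omega> g ?y)))"
      by (simp only: \<gamma>[OF v12(2)] 1)
    also have "\<dots> = twist n (v1 @ twist L (v2 @ (if v2 = p \<and> ?c then act \<omega> h w else w)))"
    proof (cases "v2 = p")
      case True
      have "act \<omega> (inv_word \<gamma>) (twist n (?x @ replicate L True @ w')) = twist n (v1 @ twist L (p @ w'))" for w'
        using \<gamma>i[of "twist L (p @ w')"] unfolding g .
      then show ?thesis unfolding True g by (cases ?c) simp_all
    next
      case False
      have "\<nexists>w'. act \<omega> g ?y = replicate L True @ w'"
      proof
        assume "\<exists>w'. act \<omega> g ?y = replicate L True @ w'"
        then obtain w' where "act \<omega> g ?y = act \<omega> g (twist L (p @ w'))" using g by auto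
        then have "v2 @ w = p @ w'" by (simp add: act_inj twist_inj)
        then show False using False v12 p by simp
      qed
      then show ?thesis using False by (simp add: below_outside \<gamma>i)
    qed
    also have "\<dots> = twist (n + L) (v @ (if drop n v = p \<and> \<phi> v then act \<omega> h w else w))"
    proof -
      have "(v2 = p \<and> ?c) \<longleftrightarrow> (drop n v = p \<and> \<phi> v)"
        using v12(1,2) by auto
      then show ?thesis
        unfolding v12(1) append_assoc twist_add[OF v12(2)] by simp
    qed
    finally show ?thesis .
  qed
  then have "lamps \<omega> h (n + L) (\<lambda>v. drop n v = p \<and> \<phi> v) u"
    unfolding lamps_def by blast
  then show ?thesis using len unfolding \<gamma>_def \<kappa>_def by blast
qed

lemma lamps_on_list:
  assumes "\<And>p. p \<in> set ps \<Longrightarrow> \<exists>u. length u \<le> M \<and> lamps \<omega> h (n + L) (\<lambda>v. drop n v = p \<and> \<phi> v) u"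
    and "distinct ps"
  shows "\<exists>u. length u \<le> length ps * M \<and> lamps \<omega> h (n + L) (\<lambda>v. drop n v \<in> set ps \<and> \<phi> v) u"
  using assms
proof (induction ps)
  case Nil
  then show ?case by (intro exI[of _ "[]"]) (simp add: lamps_def)
next
  case (Cons p ps)
  obtain u where u: "length u \<le> M" "lamps \<omega> h (n + L) (\<lambda>v. drop n v = p \<and> \<phi> v) u"
    using Cons.prems by auto
  obtain u' where u': "length u' \<le> length ps * M"
      "lamps \<omega> h (n + L) (\<lambda>v. drop n v \<in> set ps \<and> \<phi> v) u'"
    using Cons by auto
  have "lamps \<omega> h (n + L) (\<lambda>v. (drop n v = p \<and> \<phi> v) \<or> (drop n v \<in> set ps \<and> \<phi> v)) (u @ u')"
    using lamps_append[OF u(2) u'(2)] Cons.prems(2) by auto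
  moreover have "(\<lambda>v. (drop n v = p \<and> \<phi> v) \<or> (drop n v \<in> set ps \<and> \<phi> v)) =
      (\<lambda>v. drop n v \<in> set (p # ps) \<and> \<phi> v)" by auto
  ultimately show ?case using u u' by (intro exI[of _ "u @ u'"]) auto
qed

text \<open>The \<open>2^L\<close> vertices below each vertex of level \<open>n\<close> are treated one after the other. The words \<open>U\<close> and
\<open>g p\<close> are fixed once \<open>L\<close> is, so their inflations contribute at most a constant times \<open>T\<close> each, where \<open>T\<close>
bounds the factor by which the \<open>n\<close>-fold inflation lengthens words.\<close>

lemma lamps_step:
  assumes full: "range \<omega> = {L0, L1, L2}" and per: "\<And>n. \<omega> (n + q) = \<omega> n"
    and q: "q \<ge> 1" and L: "q dvd L" "L \<ge> q + 2"
  shows "\<exists>h C. (\<exists>w. act \<omega> h w \<noteq> w) \<and>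
    (\<forall>n l T. q dvd n \<longrightarrow> (\<forall>u. length (inflates n \<omega> u) \<le> T * length u) \<longrightarrow> T \<ge> 1 \<longrightarrow>
      (\<forall>\<phi>. \<exists>f. length f \<le> l \<and> lamps \<omega> h n \<phi> f) \<longrightarrow>
      (\<forall>\<phi>. \<exists>f. length f \<le> 2 ^ L * (2 * l + C * T) \<and> lamps \<omega> h (n + L) \<phi> f))"
proof -
  from seed_exists[where \<omega> = \<omega> and q = q and L = L, OF full per q L] obtain h U
    where U: "even_word U" and hw: "\<exists>w. act \<omega> h w \<noteq> w" and
    h': "\<forall>v. act \<omega> h (act \<omega> (inv_word U) (act \<omega> (inv_word h) (act \<omega> U v))) = below L (act \<omega> h) v"
    by blast
  note h = h'[rule_format]
  define ps where "ps = List.n_lists L [False, True]"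
  have ps: "distinct ps" "length ps = 2 ^ L" "\<And>p. p \<in> set ps \<longleftrightarrow> length p = L"
    by (auto simp: ps_def distinct_n_lists length_n_lists set_n_lists numeral_2_eq_2)
  define g where "g p = (SOME g. \<forall>w. act \<omega> g (twist L (p @ w)) = replicate L True @ w)" for p
  have g: "act \<omega> (g p) (twist L (p @ w)) = replicate L True @ w" if "length p = L" for p w
    using someI_ex[OF transitive_with_trivial_section[OF that, of \<omega>]] by (simp add: g_def)
  define C where "C = 2 * (\<Sum>p\<leftarrow>ps. length (g p)) + 2 * length U + 6"
  have "\<exists>f. length f \<le> 2 ^ L * (2 * l + C * T) \<and> lamps \<omega> h (n + L) \<phi> f"
    if n: "q dvd n" and T: "\<And>u. length (inflates n \<omega> u) \<le> T * length u" "T \<ge> 1"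
      and f: "\<And>\<phi>. \<exists>f. length f \<le> l \<and> lamps \<omega> h n \<phi> f" for n l T \<phi>
  proof -
    have sn: "(shift ^^ n) \<omega> = \<omega>" using shift_pow_periodic[of \<omega> q n] per n by blast
    have "\<exists>u. length u \<le> 2 * l + C * T \<and> lamps \<omega> h (n + L) (\<lambda>v. drop n v = p \<and> \<phi> v) u"
      if p: "p \<in> set ps" for p
    proof -
      have pl: "length p = L" using p ps by simp
      have "length (inflates n \<omega> (g p)) \<le> T * (\<Sum>p\<leftarrow>ps. length (g p))"
      proof -
        have "length (g p) \<le> (\<Sum>p\<leftarrow>ps. length (g p))"
          by (rule member_le_sum_list) (use p in auto)
        then show ?thesis using T(1)[of "g p"] le_trans mult_le_mono2 by meson
      qed
      then have "2 * l + 2 * length (inflates n \<omega> (g p)) + 2 * length (inflates n \<omega> U) + 6 \<le> 2 * l + C * T"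
        using T(1)[of U] T(2) by (simp add: C_def algebra_simps)
      moreover obtain u where "length u \<le> 2 * l + 2 * length (inflates n \<omega> (g p)) + 2 * length (inflates n \<omega> U) + 6"
          "lamps \<omega> h (n + L) (\<lambda>v. drop n v = p \<and> \<phi> v) u"
        using lamps_at[OF sn U h pl g[OF pl] f, of \<phi>] by (elim exE conjE)
      ultimately show ?thesis using le_trans by blast
    qed
    from lamps_on_list[of ps, OF this ps(1)]
    obtain u where u: "length u \<le> 2 ^ L * (2 * l + C * T)"
      "lamps \<omega> h (n + L) (\<lambda>v. drop n v \<in> set ps \<and> \<phi> v) u" by (auto simp: ps(2))
    have "lamps \<omega> h (n + L) \<phi> u"
      unfolding lamps_def using lampsD[OF u(2)] by (simp add: ps(3))
    then show ?thesis using u(1) by blast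
  qed
  then show ?thesis using hw by (intro exI[of _ h] exI[of _ C]) simp
qed

lemma lamps_distinct:
  assumes "lamps \<omega> h n \<phi> u" "lamps \<omega> h n \<psi> u'" "act \<omega> h w \<noteq> w" "length v = n" "\<phi> v \<noteq> \<psi> v"
  shows "act \<omega> u \<noteq> act \<omega> u'"
proof
  assume "act \<omega> u = act \<omega> u'"
  then have "act \<omega> u (twist n (v @ w)) = act \<omega> u' (twist n (v @ w))" by simp
  then show False
    unfolding lampsD[OF assms(1,4)] lampsD[OF assms(2,4)] using assms(3,5)
    by (auto simp: twist_inj split: if_splits)
qed

section \<open>The length scale of a level\<close>

text \<open>The length \<open>inflated_length \<omega> n x\<close> of the \<open>n\<close>-fold inflation of a letter \<open>x \<noteq> Kid\<close> is an entry of the row vector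
\<open>(1,1,1) M(\<omega> 0) \<dots> M(\<omega> (n-1))\<close>, and \<open>length_scale \<omega> n\<close> is the sum of that vector. The slack of \<open>x\<close> in the triangle
inequality, that is, the sum of the other two entries minus the entry of \<open>x\<close>, satisfies the recursion
below. Its coefficients are nonnegative, so in these coordinates the triangle inequalities and the
comparability of all entries are evident.\<close>

fun slack :: "(nat \<Rightarrow> letter) \<Rightarrow> nat \<Rightarrow> klein \<Rightarrow> nat" where
  "slack \<omega> 0 x = 1"
| "slack \<omega> (Suc n) x =
     (if x = vanishes_on (\<omega> n) then slack \<omega> n x
      else 2 * slack \<omega> n x + slack \<omega> n (vanishes_on (\<omega> n)))"

definition length_scale :: "(nat \<Rightarrow> letter) \<Rightarrow> nat \<Rightarrow> nat" where
  "length_scale \<omega> n = slack \<omega> n Kb + slack \<omega> n Kc + slack \<omega> n Kd"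

fun inflated_length :: "(nat \<Rightarrow> letter) \<Rightarrow> nat \<Rightarrow> klein \<Rightarrow> nat" where
  "inflated_length \<omega> 0 x = 1"
| "inflated_length \<omega> (Suc n) x =
     (if x = Kid then 1
      else if x = vanishes_on (\<omega> n) then inflated_length \<omega> n Kb + inflated_length \<omega> n Kc + inflated_length \<omega> n Kd
      else 2 * inflated_length \<omega> n x)"

lemma length_scale_0 [simp]: "length_scale \<omega> 0 = 3"
  by (simp add: length_scale_def)

lemma length_scale_Suc: "length_scale \<omega> (Suc n) = 2 * length_scale \<omega> n + slack \<omega> n (vanishes_on (\<omega> n))"
  by (cases "\<omega> n") (simp_all add: length_scale_def)

lemma inflated_length_Kid [simp]: "inflated_length \<omega> n Kid = 1"
  by (cases n) auto

lemma inflated_length_slack: "x \<noteq> Kid \<Longrightarrow> 2 * inflated_length \<omega> n x + slack \<omega> n x = length_scale \<omega> n"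
proof (induction n arbitrary: x)
  case (Suc n)
  have "2 * inflated_length \<omega> n Kb + slack \<omega> n Kb = length_scale \<omega> n" "2 * inflated_length \<omega> n Kc + slack \<omega> n Kc = length_scale \<omega> n"
    "2 * inflated_length \<omega> n Kd + slack \<omega> n Kd = length_scale \<omega> n" using Suc.IH by auto
  then show ?case using Suc.prems
    by (cases "\<omega> n"; cases x) (simp_all add: length_scale_Suc, simp_all add: length_scale_def)
qed simp

lemma sum_inflated_length: "inflated_length \<omega> n Kb + inflated_length \<omega> n Kc + inflated_length \<omega> n Kd = length_scale \<omega> n"
  using inflated_length_slack[of Kb \<omega> n] inflated_length_slack[of Kc \<omega> n] inflated_length_slack[of Kd \<omega> n] by (simp add: length_scale_def)

lemma slack_ge_1: "slack \<omega> n x \<ge> 1"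
  by (induction n) auto

lemma length_scale_ge: "length_scale \<omega> n \<ge> 3"
  using slack_ge_1[of \<omega> n Kb] slack_ge_1[of \<omega> n Kc] slack_ge_1[of \<omega> n Kd] by (simp add: length_scale_def)

lemma inflated_length_le: "inflated_length \<omega> n x \<le> length_scale \<omega> n"
  using inflated_length_slack[of x \<omega> n] length_scale_ge[of \<omega> n] by (cases "x = Kid") auto

text \<open>Inflation was defined from the root downwards; lengths are computed with the deepest inflation
performed first.\<close>

lemma inflates_Suc_right: "inflates (Suc n) \<omega> u = inflates n \<omega> (inflate (\<omega> n) u)"
proof (induction n arbitrary: \<omega>)
  case (Suc n)
  have "inflates (Suc (Suc n)) \<omega> u = inflate (\<omega> 0) (inflates (Suc n) (shift \<omega>) u)" by simp
  also have "\<dots> = inflate (\<omega> 0) (inflates n (shift \<omega>) (inflate (shift \<omega> n) u))" unfolding Suc.IH ..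
  also have "\<dots> = inflates (Suc n) \<omega> (inflate (\<omega> (Suc n)) u)" by (simp add: shift_def)
  finally show ?case .
qed simp

lemma length_inflates: "length (inflates n \<omega> u) = (\<Sum>x\<leftarrow>u. inflated_length \<omega> n x)"
proof (induction n arbitrary: u)
  case 0
  then show ?case by (simp add: sum_list_triv)
next
  case (Suc n)
  have "(\<Sum>x\<leftarrow>inflate_letter (\<omega> n) y. inflated_length \<omega> n x) = inflated_length \<omega> (Suc n) y" for y
    by (cases "\<omega> n"; cases y) (auto simp: inflate_letter_def partner_def)
  then have "(\<Sum>x\<leftarrow>inflate (\<omega> n) u. inflated_length \<omega> n x) = (\<Sum>x\<leftarrow>u. inflated_length \<omega> (Suc n) x)"
    by (induction u) auto
  then show ?case by (simp only: inflates_Suc_right Suc)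
qed

lemma length_inflates_le: "length (inflates n \<omega> u) \<le> length_scale \<omega> n * length u"
  unfolding length_inflates using inflated_length_le[of \<omega> n] by (induction u) (auto simp: add_mono)

lemma length_scale_Suc_le: "length_scale \<omega> (Suc n) \<le> 3 * length_scale \<omega> n"
  by (cases "\<omega> n") (simp_all add: length_scale_Suc, simp_all add: length_scale_def)

lemma length_scale_add_le: "length_scale \<omega> (n + m) \<le> 3 ^ m * length_scale \<omega> n"
proof (induction m)
  case (Suc m)
  then show ?case using length_scale_Suc_le[of \<omega> "n + m"] by simp
qed simp

lemma slack_mono: "n \<le> m \<Longrightarrow> slack \<omega> n x \<le> slack \<omega> m x"
  by (rule lift_Suc_mono_le[where f = "\<lambda>n. slack \<omega> n x"]) auto

lemma slack_Suc_ge: "slack \<omega> n (vanishes_on (\<omega> n)) \<le> slack \<omega> (Suc n) x"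
  by simp

locale periodic_sequence =
  fixes \<omega> :: "nat \<Rightarrow> letter" and q :: nat
  assumes period_pos: "q \<ge> 1"
    and periodic: "\<And>n. \<omega> (n + q) = \<omega> n"
    and full: "range \<omega> = {L0, L1, L2}"
begin

lemma letter_in_window: "\<exists>k\<in>{m..<m + q}. \<omega> k = l"
proof -
  note periodic_mult = periodic_mult[where \<omega> = \<omega> and q = q, OF periodic]
  have "l \<in> range \<omega>" using full by (cases l) auto
  then obtain i where i: "\<omega> i = l" by blast
  \<comment> \<open>the representative of \<open>i\<close> modulo \<open>q\<close> in the window; adding \<open>m * q\<close> keeps the difference nonnegative\<close>
  define k where "k = m + (i + m * q - m) mod q"
  have "m \<le> m * q" using period_pos by simp
  then have e: "i + m * q = k + (i + m * q - m) div q * q"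
    using mod_div_mult_eq[of "i + m * q - m" q] unfolding k_def by linarith
  have "\<omega> k = \<omega> (i + m * q)" by (subst e) (rule periodic_mult[symmetric])
  also have "\<dots> = l" using i periodic_mult by simp
  finally have "\<omega> k = l" .
  moreover have "k \<in> {m..<m + q}" using period_pos by (simp add: k_def)
  ultimately show ?thesis by blast
qed

text \<open>During one period the letter \<open>y\<close> plays the role of the vanishing letter at some time, and at that moment
its slack is added to the other two. Hence all three slacks, and then all inflated lengths, are
comparable to the length scale.\<close>

lemma slack_window:
  assumes "y \<noteq> Kid"
  shows "slack \<omega> m y \<le> slack \<omega> (m + q) x"
proof -
  obtain l where l: "y = vanishes_on l"
    using assms by (cases y) (metis vanishes_on.simps)+
  obtain k where k: "m \<le> k" "Suc k \<le> m + q" "\<omega> k = l" using letter_in_window[of m l] by auto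
  have "slack \<omega> m y \<le> slack \<omega> k (vanishes_on (\<omega> k))" using slack_mono[OF k(1)] k l by simp
  also have "\<dots> \<le> slack \<omega> (Suc k) x" by (rule slack_Suc_ge)
  also have "\<dots> \<le> slack \<omega> (m + q) x" by (rule slack_mono[OF k(2)])
  finally show ?thesis .
qed

lemma length_scale_le_slack: "length_scale \<omega> n \<le> 3 ^ Suc q * slack \<omega> n x"
proof (cases "n \<ge> q")
  case True
  define m where "m = n - q"
  have n: "n = m + q" using True by (simp add: m_def)
  have "length_scale \<omega> m \<le> 3 * slack \<omega> n x"
    using slack_window[of Kb m x] slack_window[of Kc m x] slack_window[of Kd m x] by (simp add: n length_scale_def)
  then have "3 ^ q * length_scale \<omega> m \<le> 3 ^ Suc q * slack \<omega> n x" by simp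
  then show ?thesis using length_scale_add_le[of \<omega> m q] by (simp only: n)
next
  case False
  have "length_scale \<omega> n \<le> 3 ^ n * 3" using length_scale_add_le[of \<omega> 0 n] by simp
  also have "\<dots> \<le> 3 ^ q * 3" using False by (simp add: power_increasing)
  also have "\<dots> \<le> 3 ^ Suc q * slack \<omega> n x" using slack_ge_1[of \<omega> n x] by simp
  finally show ?thesis .
qed

lemma length_scale_Suc_ge: "3 ^ Suc q * length_scale \<omega> (Suc n) \<ge> (2 * 3 ^ Suc q + 1) * length_scale \<omega> n"
  using length_scale_le_slack[of n "vanishes_on (\<omega> n)"] by (simp add: length_scale_Suc algebra_simps)

lemma length_scale_le_inflated_length:
  assumes "x \<noteq> Kid"
  shows "length_scale \<omega> n \<le> 3 ^ Suc q * inflated_length \<omega> n x"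
proof -
  have "2 * inflated_length \<omega> n x \<ge> slack \<omega> n (if x = Kb then Kc else Kb) + slack \<omega> n (if x = Kd then Kc else Kd)"
    using inflated_length_slack[OF assms, of \<omega> n] assms by (cases x) (auto simp: length_scale_def)
  then have "3 ^ Suc q * (2 * inflated_length \<omega> n x) \<ge> 3 ^ Suc q * slack \<omega> n (if x = Kb then Kc else Kb)
      + 3 ^ Suc q * slack \<omega> n (if x = Kd then Kc else Kd)"
    unfolding add_mult_distrib2[symmetric] by (rule mult_le_mono2)
  moreover have "3 ^ Suc q * slack \<omega> n y \<ge> length_scale \<omega> n" for y by (rule length_scale_le_slack)
  ultimately have "length_scale \<omega> n + length_scale \<omega> n \<le> 3 ^ Suc q * (2 * inflated_length \<omega> n x)"
    by (meson add_mono le_trans)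
  then show ?thesis by simp
qed

end

section \<open>Contraction and the upper bound\<close>

text \<open>A weight for which the two sections of a word together weigh at most twice as much as the word, up to an
additive error. The weight of \<open>Kid\<close> is the
amount gained when two letters are merged because the letter between them acts trivially on the child in
question; giving \<open>Kid\<close> this positive weight makes the gain the same for merges that cancel.\<close>

definition cost :: "(nat \<Rightarrow> letter) \<Rightarrow> nat \<Rightarrow> klein \<Rightarrow> nat" where
  "cost \<omega> n x =
     (if x = Kid then (case n of 0 \<Rightarrow> 1 | Suc m \<Rightarrow> slack \<omega> m (vanishes_on (\<omega> m))) else inflated_length \<omega> n x)"

text \<open>The triangle inequalities in disguise; equality holds for the merges which undo the inflation.\<close>

lemma cost_mult:
  "cost \<omega> (Suc n) (klein_mult y x) + cost \<omega> (Suc n) Kid \<le> cost \<omega> (Suc n) y + cost \<omega> (Suc n) x"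
  using inflated_length_slack[of Kb \<omega> n] inflated_length_slack[of Kc \<omega> n] inflated_length_slack[of Kd \<omega> n] slack_ge_1[of \<omega> n]
  by (cases "\<omega> n"; cases x; cases y) (simp_all add: cost_def length_scale_def)

lemma cost_vanishing:
  "x = Kid \<or> x = vanishes_on (\<omega> n) \<Longrightarrow> cost \<omega> (Suc n) x \<le> 2 * cost \<omega> n x + cost \<omega> (Suc n) Kid"
  using inflated_length_slack[of Kb \<omega> n] inflated_length_slack[of Kc \<omega> n] inflated_length_slack[of Kd \<omega> n]
  by (cases "\<omega> n"; cases x) (simp_all add: cost_def length_scale_def)

lemma cost_nonvanishing:
  "\<not> (x = Kid \<or> x = vanishes_on (\<omega> n)) \<Longrightarrow> cost \<omega> (Suc n) x = 2 * cost \<omega> n x"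
  by (simp add: cost_def)

definition costs :: "(nat \<Rightarrow> letter) \<Rightarrow> nat \<Rightarrow> klein list \<Rightarrow> nat" where
  "costs \<omega> n u = (\<Sum>x\<leftarrow>u. cost \<omega> n x)"

lemma costs_simps [simp]: "costs \<omega> n [] = 0" "costs \<omega> n (x # u) = cost \<omega> n x + costs \<omega> n u"
  by (simp_all add: costs_def)

text \<open>Reading \<open>a x_1 a x_2 \<dots>\<close> at a fixed child, the letters act alternately as themselves and as \<open>a\<close> or the
identity. The flag tells that the next letter acts as itself, and \<open>y\<close> collects the letters merged so far.\<close>

fun section_from :: "letter \<Rightarrow> bool \<Rightarrow> klein \<Rightarrow> klein list \<Rightarrow> klein list" where
  "section_from l t y [] = [y]"
| "section_from l True y (x # u) = section_from l False (klein_mult y x) u"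
| "section_from l False y (x # u) =
     (if x = Kid \<or> x = vanishes_on l then section_from l True y u else y # section_from l True Kid u)"

definition section_word :: "letter \<Rightarrow> bool \<Rightarrow> klein list \<Rightarrow> klein list" where
  "section_word l i u = Kid # section_from l (\<not> i) Kid u"

lemma act_section_from:
  "act \<omega> u (i # directed y (shift \<omega>) w) =
     (i \<noteq> odd (length u)) # act (shift \<omega>) (section_from (\<omega> 0) (\<not> i) y u) (aut_a w)"
proof (induction u arbitrary: i y w)
  case (Cons x u)
  show ?case
  proof (cases i)
    case False
    then show ?thesis using Cons[of True "klein_mult y x" w] by (simp add: directed_mult)
  next
    case True
    show ?thesis
    proof (cases "x = Kid \<or> x = vanishes_on (\<omega> 0)")
      case 1: True
      then show ?thesis using True Cons[of False y w] by (auto simp: letter_hom_def)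
    next
      case 2: False
      then show ?thesis using True Cons[of False Kid "aut_a (directed y (shift \<omega>) w)"]
        by (auto simp: letter_hom_def)
    qed
  qed
qed simp

lemma act_section_word:
  "act \<omega> u (i # w) = (i \<noteq> odd (length u)) # act (shift \<omega>) (section_word (\<omega> 0) i u) w"
  using act_section_from[of \<omega> u i Kid w] by (simp add: section_word_def)

text \<open>The same letter acts as itself on one child and through \<open>\<omega>_n\<close> on the other. If \<open>\<omega>_n\<close> vanishes on it, its
weight may grow by more than the factor \<open>2\<close>, but the merge it causes on the other child pays for the excess.\<close>

lemma costs_section_from:
  "costs \<omega> (Suc n) (section_from (\<omega> n) True y u) + costs \<omega> (Suc n) (section_from (\<omega> n) False y' u)
     \<le> 2 * costs \<omega> n u + cost \<omega> (Suc n) y + cost \<omega> (Suc n) y'"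
proof (induction u arbitrary: y y')
  case (Cons x u)
  show ?case
  proof (cases "x = Kid \<or> x = vanishes_on (\<omega> n)")
    case True
    then show ?thesis
      using Cons[of y' "klein_mult y x"] cost_mult[of \<omega> n y x] cost_vanishing[where \<omega> = \<omega> and n = n, OF True] by auto
  next
    case False
    then show ?thesis
      using Cons[of Kid "klein_mult y x"] cost_mult[of \<omega> n y x] cost_nonvanishing[where \<omega> = \<omega> and n = n, OF False] by auto
  qed
qed simp

lemma costs_section_word:
  "costs \<omega> (Suc n) (section_word (\<omega> n) False u) + costs \<omega> (Suc n) (section_word (\<omega> n) True u)
     \<le> 2 * costs \<omega> n u + 4 * cost \<omega> (Suc n) Kid"
  using costs_section_from[of \<omega> n Kid u Kid] by (simp add: section_word_def)

text \<open>An element is determined by the permutations at the vertices above level \<open>n\<close> and the words describing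
its sections at level \<open>n\<close>; the code lists them, with \<open>Inr False\<close> as an end marker for the words.\<close>

fun code :: "nat \<Rightarrow> (nat \<Rightarrow> letter) \<Rightarrow> klein list \<Rightarrow> (klein + bool) list" where
  "code 0 \<omega> u = map Inl u @ [Inr False]"
| "code (Suc n) \<omega> u = Inr (odd (length u)) #
     code n (shift \<omega>) (section_word (\<omega> 0) False u) @ code n (shift \<omega>) (section_word (\<omega> 0) True u)"

lemma code_prefix_free: "code n \<omega> u @ r = code n \<omega> u' @ r' \<Longrightarrow> act \<omega> u = act \<omega> u' \<and> r = r'"
proof (induction n arbitrary: \<omega> u u' r r')
  case 0
  then have "map Inl u @ Inr False # r = map Inl u' @ Inr False # (r' :: (klein + bool) list)" by simp
  then have "u = u' \<and> r = r'"
  proof (induction u arbitrary: u')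
    case Nil
    then show ?case by (cases u') auto
  next
    case (Cons x u)
    then show ?case by (cases u') auto
  qed
  then show ?case by auto
next
  case (Suc n)
  let ?s = "\<lambda>i u. section_word (\<omega> 0) i u"
  have p: "odd (length u) = odd (length u')"
    and "code n (shift \<omega>) (?s False u) @ (code n (shift \<omega>) (?s True u) @ r) =
      code n (shift \<omega>) (?s False u') @ (code n (shift \<omega>) (?s True u') @ r')"
    using Suc.prems by simp_all
  then have F: "act (shift \<omega>) (?s False u) = act (shift \<omega>) (?s False u')"
    and "code n (shift \<omega>) (?s True u) @ r = code n (shift \<omega>) (?s True u') @ r'"
    using Suc.IH by blast+
  then have T: "act (shift \<omega>) (?s True u) = act (shift \<omega>) (?s True u')" and r: "r = r'"
    using Suc.IH by blast+
  have "act \<omega> u v = act \<omega> u' v" for v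
  proof (cases v)
    case (Cons i w)
    then show ?thesis using p F T by (cases i) (simp_all add: act_section_word)
  qed simp
  then show ?case using r by blast
qed

text \<open>The additive error at level \<open>k\<close> comes from the ends of the \<open>2^k\<close> words there and is of the order of the
weights at that level; \<open>sum_cost_Kid\<close> bounds the sum of all errors by the final length scale.\<close>

lemma length_code:
  assumes "\<And>x. \<mu> \<le> c * cost \<omega> (m + n) x"
  shows "\<mu> * length (code n ((shift ^^ m) \<omega>) u) \<le>
    c * (2 ^ n * costs \<omega> m u + 2 ^ Suc n * (\<Sum>k<n. cost \<omega> (Suc (m + k)) Kid)) + 2 ^ Suc n * \<mu>"
proof -
  have "\<mu> * length (code n ((shift ^^ m) \<omega>) u) + \<mu> \<le>
    c * (2 ^ n * costs \<omega> m u + 2 ^ Suc n * (\<Sum>k<n. cost \<omega> (Suc (m + k)) Kid)) + 2 ^ Suc n * \<mu>"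
    using assms
  proof (induction n arbitrary: m u)
    case 0
    have "\<mu> * length u \<le> c * costs \<omega> m u"
    proof (induction u)
      case (Cons x u)
      then show ?case using 0[of x] by (simp add: algebra_simps)
    qed simp
    then show ?case by simp
  next
    case (Suc n)
    let ?s = "\<lambda>i. section_word (\<omega> m) i u"
    let ?G = "\<lambda>m n. \<Sum>k<n. cost \<omega> (Suc (m + k)) Kid"
    let ?l = "\<lambda>i. length (code n ((shift ^^ Suc m) \<omega>) (?s i))"
    have IH: "\<mu> * ?l i + \<mu> \<le>
        c * (2 ^ n * costs \<omega> (Suc m) (?s i) + 2 ^ Suc n * ?G (Suc m) n) + 2 ^ Suc n * \<mu>" for i
      using Suc.IH[of "Suc m" "?s i"] Suc.prems by (simp add: add_Suc_right[symmetric] del: add_Suc_right funpow.simps)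
    have G: "?G m (Suc n) = cost \<omega> (Suc m) Kid + ?G (Suc m) n"
      by (subst sum.lessThan_Suc_shift) simp
    have "\<mu> * length (code (Suc n) ((shift ^^ m) \<omega>) u) + \<mu> = (\<mu> * ?l False + \<mu>) + (\<mu> * ?l True + \<mu>)"
      by (simp add: shift_pow algebra_simps)
    also have "\<dots> \<le> c * (2 ^ n * (costs \<omega> (Suc m) (?s False) + costs \<omega> (Suc m) (?s True)) + 2 * (2 ^ Suc n * ?G (Suc m) n))
        + 2 * (2 ^ Suc n * \<mu>)"
      using IH[of False] IH[of True] by (simp add: algebra_simps)
    also have "\<dots> \<le> c * (2 ^ n * (2 * costs \<omega> m u + 4 * cost \<omega> (Suc m) Kid) + 2 * (2 ^ Suc n * ?G (Suc m) n))
        + 2 * (2 ^ Suc n * \<mu>)"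
      by (intro add_mono mult_le_mono2 costs_section_word order_refl)
    also have "\<dots> = c * (2 ^ Suc n * costs \<omega> m u + 2 ^ Suc (Suc n) * ?G m (Suc n)) + 2 ^ Suc (Suc n) * \<mu>"
      unfolding G by (simp add: algebra_simps)
    finally show ?case .
  qed
  then show ?thesis by simp
qed

lemma sum_cost_Kid: "(\<Sum>k<n. cost \<omega> (Suc k) Kid) \<le> length_scale \<omega> n"
proof (induction n)
  case (Suc n)
  then show ?case using length_scale_Suc[of \<omega> n] by (simp add: cost_def)
qed simp

lemma card_lists_le: "card {xs :: (klein + bool) list. length xs \<le> N} \<le> 7 ^ N"
  and finite_lists_le: "finite {xs :: (klein + bool) list. length xs \<le> N}"
proof -
  have U: "(UNIV :: klein set) = {Kid, Kb, Kc, Kd}" by (auto intro: klein.exhaust)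
  have fin: "finite (UNIV :: (klein + bool) set)" and card: "card (UNIV :: (klein + bool) set) = 6"
    unfolding UNIV_Plus_UNIV[symmetric] by (auto simp: card_Plus U UNIV_bool)
  have e: "{xs :: (klein + bool) list. length xs \<le> N} = {xs. set xs \<subseteq> UNIV \<and> length xs \<le> N}" by simp
  show "finite {xs :: (klein + bool) list. length xs \<le> N}"
    unfolding e using finite_lists_length_le[OF fin] by blast
  have "card {xs :: (klein + bool) list. length xs \<le> N} = (\<Sum>i\<le>N. 6 ^ i)"
    unfolding e card_lists_length_le[OF fin] card ..
  also have "\<dots> \<le> 7 ^ N"
  proof (induction N)
    case (Suc N)
    have "(6 :: nat) ^ N \<le> 7 ^ N" by (rule power_mono) auto
    then show ?case using Suc by simp
  qed simp
  finally show "card {xs :: (klein + bool) list. length xs \<le> N} \<le> 7 ^ N" .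
qed

lemma (in periodic_sequence) card_act_le:
  "finite (act \<omega> ` {u. length u \<le> 2 * length_scale \<omega> n})"
  "card (act \<omega> ` {u. length u \<le> 2 * length_scale \<omega> n}) \<le> 7 ^ ((4 * 3 ^ Suc q + 2) * 2 ^ n)"
proof -
  let ?T = "length_scale \<omega> n" and ?c = "3 ^ Suc q :: nat"
  let ?N = "(4 * ?c + 2) * 2 ^ n"
  let ?S = "{u :: klein list. length u \<le> 2 * ?T}"
  have c: "?T \<le> ?c * cost \<omega> (0 + n) x" for x
  proof (cases "x = Kid")
    case True
    show ?thesis
    proof (cases n)
      case 0
      then show ?thesis using True by (simp add: cost_def)
    next
      case (Suc m)
      then show ?thesis using True length_scale_le_slack[of n "vanishes_on (\<omega> m)"] by (simp add: cost_def)
    qed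
  next
    case False
    then show ?thesis using length_scale_le_inflated_length[of x n] by (simp add: cost_def)
  qed
  have len: "length (code n \<omega> u) \<le> ?N" if u: "u \<in> ?S" for u
  proof -
    have "costs \<omega> 0 u = length u" by (induction u) (auto simp: cost_def)
    then have "costs \<omega> 0 u \<le> 2 * ?T" using u by simp
    then have "?c * (2 ^ n * costs \<omega> 0 u + 2 ^ Suc n * (\<Sum>k<n. cost \<omega> (Suc k) Kid)) + 2 ^ Suc n * ?T
        \<le> ?c * (2 ^ n * (2 * ?T) + 2 ^ Suc n * ?T) + 2 ^ Suc n * ?T"
      by (intro add_mono mult_le_mono2 sum_cost_Kid order_refl)
    also have "\<dots> = ?T * ?N" by (simp add: algebra_simps)
    finally have le: "?c * (2 ^ n * costs \<omega> 0 u + 2 ^ Suc n * (\<Sum>k<n. cost \<omega> (Suc k) Kid)) + 2 ^ Suc n * ?T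
        \<le> ?T * ?N" .
    have "?T * length (code n \<omega> u) \<le> ?T * ?N"
      using length_code[of ?T ?c \<omega> 0 n u, OF c] le unfolding funpow_0 add_0 by (rule order_trans)
    then show ?thesis using length_scale_ge[of \<omega> n] by simp
  qed
  define f where "f c = act \<omega> (SOME u. code n \<omega> u = c)" for c
  have f: "act \<omega> u = f (code n \<omega> u)" for u
  proof -
    have "code n \<omega> (SOME u'. code n \<omega> u' = code n \<omega> u) = code n \<omega> u" by (rule someI) simp
    then have "code n \<omega> (SOME u'. code n \<omega> u' = code n \<omega> u) @ [] = code n \<omega> u @ []" by simp
    from code_prefix_free[OF this] show ?thesis unfolding f_def by simp
  qed
  have sub: "act \<omega> ` ?S \<subseteq> f ` {xs. length xs \<le> ?N}"
    using f len by blast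
  show "finite (act \<omega> ` ?S)" using finite_subset[OF sub] finite_lists_le by blast
  have "card (act \<omega> ` ?S) \<le> card (f ` {xs. length xs \<le> ?N})"
    by (rule card_mono[OF _ sub]) (intro finite_imageI finite_lists_le)
  also have "\<dots> \<le> card {xs :: (klein + bool) list. length xs \<le> ?N}"
    by (rule card_image_le) (rule finite_lists_le)
  also have "\<dots> \<le> 7 ^ ?N" by (rule card_lists_le)
  finally show "card (act \<omega> ` ?S) \<le> 7 ^ ?N" .
qed

section \<open>Balls in the Grigorchuk group\<close>

lemma mult_grigorchuk: "f \<otimes>\<^bsub>grigorchuk_group \<omega>\<^esub> g = g \<circ> f"
  by (simp add: grigorchuk_group_def subgroup_generated_def tree_aut_def)

lemma one_grigorchuk: "\<one>\<^bsub>grigorchuk_group \<omega>\<^esub> = id"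
  by (simp add: grigorchuk_group_def subgroup_generated_def tree_aut_def)

lemma gen_involution: "s \<in> grigorchuk_gens \<omega> \<Longrightarrow> s \<circ> s = id"
  by (auto simp: grigorchuk_gens_def fun_eq_iff)

lemma gen_carrier: "s \<in> grigorchuk_gens \<omega> \<Longrightarrow> s \<in> carrier (grigorchuk_group \<omega>)"
  by (simp add: carrier_grigorchuk_group generate.incl)

lemma inv_gen: "s \<in> grigorchuk_gens \<omega> \<Longrightarrow> m_inv (grigorchuk_group \<omega>) s = s"
  by (rule group.inv_equality[OF group_grigorchuk_group])
     (auto simp: mult_grigorchuk one_grigorchuk gen_involution gen_carrier)

lemma inv_gen_tree_aut:
  assumes "s \<in> grigorchuk_gens \<omega>"
  shows "m_inv tree_aut s = s"
proof (rule group.inv_equality[OF group_tree_aut])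
  show "s \<otimes>\<^bsub>tree_aut\<^esub> s = \<one>\<^bsub>tree_aut\<^esub>" using gen_involution[OF assms] by (simp add: tree_aut_def)
qed (use assms grigorchuk_gens_carrier in blast)+

lemma gens_with_inverses:
  "grigorchuk_gens \<omega> \<union> m_inv (grigorchuk_group \<omega>) ` grigorchuk_gens \<omega> = grigorchuk_gens \<omega>"
  by (auto simp: inv_gen)

lemma word_prod_Nil [simp]: "word_prod (grigorchuk_group \<omega>) [] = id"
  by (simp add: word_prod_def one_grigorchuk)

lemma word_prod_Cons [simp]:
  "word_prod (grigorchuk_group \<omega>) (s # ws) = word_prod (grigorchuk_group \<omega>) ws \<circ> s"
  by (simp add: word_prod_def mult_grigorchuk)

lemma word_prod_append:
  "word_prod (grigorchuk_group \<omega>) (ws @ ws') = word_prod (grigorchuk_group \<omega>) ws' \<circ> word_prod (grigorchuk_group \<omega>) ws"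
  by (induction ws) auto

lemma act_as_word_prod:
  "\<exists>ws. length ws \<le> 2 * length u \<and> set ws \<subseteq> grigorchuk_gens \<omega> \<and> word_prod (grigorchuk_group \<omega>) ws = act \<omega> u"
proof (induction u)
  case Nil
  show ?case by (intro exI[of _ "[]"]) (auto simp: fun_eq_iff)
next
  case (Cons x u)
  then obtain ws where ws: "length ws \<le> 2 * length u" "set ws \<subseteq> grigorchuk_gens \<omega>"
      "word_prod (grigorchuk_group \<omega>) ws = act \<omega> u" by blast
  show ?case
    using ws by (intro exI[of _ "(if x = Kid then [aut_a] else [aut_a, directed x \<omega>]) @ ws"])
      (cases x; auto simp: fun_eq_iff grigorchuk_gens_def)
qed

lemma word_prod_as_act:
  assumes "set ws \<subseteq> grigorchuk_gens \<omega>"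
  shows "\<exists>u. length u \<le> 2 * length ws \<and> act \<omega> u = word_prod (grigorchuk_group \<omega>) ws"
  using assms
proof (induction ws)
  case Nil
  show ?case by (intro exI[of _ "[]"]) (auto simp: fun_eq_iff)
next
  case (Cons s ws)
  then obtain u where u: "length u \<le> 2 * length ws" "act \<omega> u = word_prod (grigorchuk_group \<omega>) ws" by auto
  have "\<exists>u0. length u0 \<le> 2 \<and> act \<omega> u0 = s"
  proof (cases "s = aut_a")
    case True
    then show ?thesis by (intro exI[of _ "[Kid]"]) (auto simp: fun_eq_iff)
  next
    case False
    then obtain x where "s = directed x \<omega>" using Cons.prems by (auto simp: grigorchuk_gens_def)
    then show ?thesis by (intro exI[of _ "[Kid, x]"]) (auto simp: fun_eq_iff)
  qed
  then obtain u0 where "length u0 \<le> 2" "act \<omega> u0 = s" by blast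
  then show ?case using u by (intro exI[of _ "u0 @ u"]) (auto simp: fun_eq_iff act_append)
qed

lemma carrier_eq_word_prods:
  "carrier (grigorchuk_group \<omega>) =
     {word_prod (grigorchuk_group \<omega>) ws | ws. set ws \<subseteq> grigorchuk_gens \<omega>}"
proof (intro equalityI subsetI)
  fix g assume "g \<in> carrier (grigorchuk_group \<omega>)"
  then have "g \<in> generate tree_aut (grigorchuk_gens \<omega>)" by (simp add: carrier_grigorchuk_group)
  then show "g \<in> {word_prod (grigorchuk_group \<omega>) ws | ws. set ws \<subseteq> grigorchuk_gens \<omega>}"
  proof (induction rule: generate.induct)
    case one
    have "\<one>\<^bsub>tree_aut\<^esub> = word_prod (grigorchuk_group \<omega>) []" by (simp add: tree_aut_def)
    then show ?case by (metis (mono_tags, lifting) empty_subsetI list.set(1) mem_Collect_eq)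
  next
    case (incl s)
    then show ?case by (intro CollectI exI[of _ "[s]"]) auto
  next
    case (inv s)
    then show ?case by (intro CollectI exI[of _ "[s]"]) (auto simp: inv_gen_tree_aut)
  next
    case (eng g1 g2)
    then obtain ws1 ws2 where "set ws1 \<subseteq> grigorchuk_gens \<omega>" "g1 = word_prod (grigorchuk_group \<omega>) ws1"
      "set ws2 \<subseteq> grigorchuk_gens \<omega>" "g2 = word_prod (grigorchuk_group \<omega>) ws2" by blast
    then show ?case
      by (intro CollectI exI[of _ "ws1 @ ws2"]) (auto simp: word_prod_append tree_aut_def)
  qed
next
  fix g assume "g \<in> {word_prod (grigorchuk_group \<omega>) ws | ws. set ws \<subseteq> grigorchuk_gens \<omega>}"
  then obtain ws where ws: "set ws \<subseteq> grigorchuk_gens \<omega>" "g = word_prod (grigorchuk_group \<omega>) ws" by blast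
  interpret group "grigorchuk_group \<omega>" by (rule group_grigorchuk_group)
  have "foldr (\<otimes>\<^bsub>grigorchuk_group \<omega>\<^esub>) ws \<one>\<^bsub>grigorchuk_group \<omega>\<^esub> \<in> carrier (grigorchuk_group \<omega>)"
    using ws(1) by (induction ws) (auto simp: gen_carrier)
  then show "g \<in> carrier (grigorchuk_group \<omega>)" using ws(2) by (simp add: word_prod_def)
qed

definition ball :: "(nat \<Rightarrow> letter) \<Rightarrow> nat \<Rightarrow> (vertex \<Rightarrow> vertex) set" where
  "ball \<omega> n = {g \<in> carrier (grigorchuk_group \<omega>).
     word_length (grigorchuk_group \<omega>) (grigorchuk_gens \<omega>) g \<le> n}"

lemma growth_eq_card_ball: "growth (grigorchuk_group \<omega>) (grigorchuk_gens \<omega>) n = card (ball \<omega> n)"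
  by (simp add: growth_def ball_def)

lemma ball_subset: "ball \<omega> n \<subseteq> act \<omega> ` {u. length u \<le> 2 * n}"
proof
  fix g assume g: "g \<in> ball \<omega> n"
  let ?P = "\<lambda>k. \<exists>ws. length ws = k \<and> set ws \<subseteq> grigorchuk_gens \<omega> \<and> word_prod (grigorchuk_group \<omega>) ws = g"
  have "\<exists>k. ?P k" using g unfolding ball_def carrier_eq_word_prods by blast
  then have "?P (LEAST k. ?P k)" by (rule LeastI_ex)
  moreover have "(LEAST k. ?P k) \<le> n" using g by (simp add: ball_def word_length_def gens_with_inverses)
  ultimately obtain ws where "length ws \<le> n" "set ws \<subseteq> grigorchuk_gens \<omega>"
      "word_prod (grigorchuk_group \<omega>) ws = g" by metis
  then obtain u where "length u \<le> 2 * length ws" "act \<omega> u = g"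
    using word_prod_as_act[of ws \<omega>] by auto
  then show "g \<in> act \<omega> ` {u. length u \<le> 2 * n}"
    using \<open>length ws \<le> n\<close> by (intro image_eqI[of _ _ u]) auto
qed

lemma act_in_ball:
  assumes "2 * length u \<le> n"
  shows "act \<omega> u \<in> ball \<omega> n"
proof -
  obtain ws where ws: "length ws \<le> 2 * length u" "set ws \<subseteq> grigorchuk_gens \<omega>"
      "word_prod (grigorchuk_group \<omega>) ws = act \<omega> u" using act_as_word_prod by blast
  then have "word_length (grigorchuk_group \<omega>) (grigorchuk_gens \<omega>) (act \<omega> u) \<le> length ws"
    unfolding word_length_def gens_with_inverses by (intro Least_le) blast
  moreover have "act \<omega> u \<in> carrier (grigorchuk_group \<omega>)"
    unfolding carrier_eq_word_prods using ws by (intro CollectI exI[of _ ws]) simp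
  ultimately show ?thesis using ws assms by (simp add: ball_def)
qed

context periodic_sequence
begin

lemma finite_ball_total: "finite (ball \<omega> (length_scale \<omega> n))"
  using finite_subset[OF ball_subset] card_act_le(1)[of n] by blast

lemma length_scale_ge_pow: "2 ^ n \<le> length_scale \<omega> n"
  by (induction n) (auto simp: length_scale_Suc)

lemma length_scale_mono: "m \<le> n \<Longrightarrow> length_scale \<omega> m \<le> length_scale \<omega> n"
  by (rule lift_Suc_mono_le) (auto simp: length_scale_Suc)

lemma finite_ball: "finite (ball \<omega> n)"
proof -
  have "n \<le> length_scale \<omega> n" using length_scale_ge_pow[of n] less_exp[of n] by linarith
  then have "ball \<omega> n \<subseteq> ball \<omega> (length_scale \<omega> n)" by (auto simp: ball_def)
  then show ?thesis using finite_subset finite_ball_total by blast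
qed

lemma card_ball_mono: "m \<le> n \<Longrightarrow> card (ball \<omega> m) \<le> card (ball \<omega> n)"
  by (rule card_mono[OF finite_ball]) (auto simp: ball_def)

lemma card_ball_le: "n \<le> length_scale \<omega> m \<Longrightarrow> card (ball \<omega> n) \<le> 7 ^ ((4 * 3 ^ Suc q + 2) * 2 ^ m)"
proof -
  assume "n \<le> length_scale \<omega> m"
  then have "ball \<omega> n \<subseteq> act \<omega> ` {u. length u \<le> 2 * length_scale \<omega> m}"
    using ball_subset[of \<omega> n] by force
  then show ?thesis using card_mono[OF card_act_le(1)] card_act_le(2) le_trans by blast
qed

lemma length_scale_growth: "real (length_scale \<omega> (n + m)) \<ge> (2 + 1 / 3 ^ Suc q) ^ m * real (length_scale \<omega> n)"
proof (induction m)
  case (Suc m)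
  let ?c = "3 ^ Suc q :: real"
  have "real ((2 * 3 ^ Suc q + 1) * length_scale \<omega> (n + m)) \<le> real (3 ^ Suc q * length_scale \<omega> (Suc (n + m)))"
    using length_scale_Suc_ge by (simp only: of_nat_le_iff)
  then have "(2 * ?c + 1) * real (length_scale \<omega> (n + m)) \<le> ?c * real (length_scale \<omega> (Suc (n + m)))"
    by (simp only: of_nat_mult of_nat_add of_nat_power of_nat_numeral of_nat_1)
  moreover have "(2 + 1 / ?c) * real (length_scale \<omega> (n + m)) = (2 * ?c + 1) * real (length_scale \<omega> (n + m)) / ?c"
    by (simp add: field_simps)
  ultimately have 1: "(2 + 1 / ?c) * real (length_scale \<omega> (n + m)) \<le> real (length_scale \<omega> (Suc (n + m)))"
    by (simp add: field_simps)
  have "(2 + 1 / ?c) ^ Suc m * real (length_scale \<omega> n) = (2 + 1 / ?c) * ((2 + 1 / ?c) ^ m * real (length_scale \<omega> n))"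
    by simp
  also have "\<dots> \<le> (2 + 1 / ?c) * real (length_scale \<omega> (n + m))"
    by (intro mult_left_mono Suc) simp
  also note 1
  finally show ?case by simp
qed simp

text \<open>Each level multiplies the length scale by at least \<open>2 + \<delta>\<close> with a fixed \<open>\<delta> > 0\<close>, so over \<open>L\<close> levels it
outgrows \<open>2^L\<close> by any prescribed factor. The factor \<open>4\<close> absorbs the two copies used in \<open>seed_exists\<close> and the
inflated auxiliary words.\<close>

lemma block_length: "\<exists>L. q dvd L \<and> L \<ge> q + 2 \<and> (\<forall>n. 2 ^ L * (4 * length_scale \<omega> n) \<le> length_scale \<omega> (n + L))"
proof -
  let ?c = "3 ^ Suc q :: nat"
  \<comment> \<open>by Bernoulli's inequality, \<open>(1 + 1 / (2 c))^L \<ge> 4\<close> as soon as \<open>L \<ge> 6 c\<close>\<close>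
  define L where "L = 8 * ?c * q"
  have c: "?c \<ge> 1" by simp
  have "8 * ?c * q \<ge> 8 * q" using c by simp
  then have L: "L \<ge> q + 2" using period_pos unfolding L_def by linarith
  have "2 ^ L * (4 * length_scale \<omega> n) \<le> length_scale \<omega> (n + L)" for n
  proof -
    have "L \<ge> 8 * ?c" using period_pos by (simp add: L_def)
    then have "real L \<ge> 8 * real ?c" by (metis of_nat_le_iff of_nat_mult of_nat_numeral)
    then have "real L * (1 / (2 * real ?c)) \<ge> 4" by (simp add: field_simps)
    then have "4 \<le> 1 + real L * (1 / (2 * real ?c))" by simp
    also have "\<dots> \<le> (1 + 1 / (2 * real ?c)) ^ L"
      by (rule Bernoulli_inequality) (simp add: order_trans[of "-1" 0])
    finally have "2 ^ L * 4 \<le> 2 ^ L * (1 + 1 / (2 * real ?c)) ^ L" by simp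
    also have "\<dots> = (2 + 1 / real ?c) ^ L"
      unfolding power_mult_distrib[symmetric] by (simp add: algebra_simps)
    finally have "2 ^ L * 4 * real (length_scale \<omega> n) \<le> (2 + 1 / real ?c) ^ L * real (length_scale \<omega> n)"
      by (rule mult_right_mono) simp
    also have "\<dots> \<le> real (length_scale \<omega> (n + L))" using length_scale_growth[of L n] by simp
    finally have "real (2 ^ L * (4 * length_scale \<omega> n)) \<le> real (length_scale \<omega> (n + L))" by simp
    then show ?thesis by (simp only: of_nat_le_iff)
  qed
  then show ?thesis using L by (intro exI[of _ L]) (simp add: L_def)
qed

text \<open>Iterating \<open>lamps_step\<close> produces, for every set of vertices of level \<open>n = j L\<close>, an element whose lamps are
on exactly there; these \<open>2^(2^n)\<close> elements are distinct, and their lengths are at most a constant times the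
length scale.\<close>

lemma card_ball_ge: "\<exists>L K. L \<ge> 1 \<and> K \<ge> 1 \<and> (\<forall>j. 2 ^ (2 ^ (j * L)) \<le> card (ball \<omega> (K * length_scale \<omega> (j * L))))"
proof -
  obtain L where L: "q dvd L" "L \<ge> q + 2" and T: "\<And>n. 2 ^ L * (4 * length_scale \<omega> n) \<le> length_scale \<omega> (n + L)"
    using block_length by blast
  obtain h C where h: "\<exists>w. act \<omega> h w \<noteq> w" and step:
    "\<forall>n l T. q dvd n \<longrightarrow> (\<forall>u. length (inflates n \<omega> u) \<le> T * length u) \<longrightarrow> T \<ge> 1 \<longrightarrow>
      (\<forall>\<phi>. \<exists>f. length f \<le> l \<and> lamps \<omega> h n \<phi> f) \<longrightarrow>
      (\<forall>\<phi>. \<exists>f. length f \<le> 2 ^ L * (2 * l + C * T) \<and> lamps \<omega> h (n + L) \<phi> f)"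
    using lamps_step[where \<omega> = \<omega> and q = q and L = L, OF full periodic period_pos L] by blast
  obtain w where w: "act \<omega> h w \<noteq> w" using h by blast
  define K where "K = length h + C + 1"
  have words: "\<forall>\<phi>. \<exists>f. length f \<le> K * length_scale \<omega> (j * L) \<and> lamps \<omega> h (j * L) \<phi> f" for j
  proof (induction j)
    case 0
    show ?case
    proof
      fix \<phi> :: "vertex \<Rightarrow> bool"
      show "\<exists>f. length f \<le> K * length_scale \<omega> (0 * L) \<and> lamps \<omega> h (0 * L) \<phi> f"
        by (intro exI[of _ "if \<phi> [] then h else []"]) (auto simp: lamps_def K_def)
    qed
  next
    case (Suc j)
    let ?n = "j * L" and ?T = "length_scale \<omega> (j * L)"
    have "q dvd ?n" using L by simp
    moreover have "\<forall>u. length (inflates ?n \<omega> u) \<le> ?T * length u" by (simp add: length_inflates_le)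
    moreover have "?T \<ge> 1" using length_scale_ge[of \<omega> ?n] by simp
    ultimately have "\<forall>\<phi>. \<exists>f. length f \<le> 2 ^ L * (2 * (K * ?T) + C * ?T) \<and> lamps \<omega> h (?n + L) \<phi> f"
      using step Suc.IH by blast
    moreover have "2 ^ L * (2 * (K * ?T) + C * ?T) \<le> K * length_scale \<omega> (?n + L)"
    proof -
      have "C * ?T \<le> K * ?T" by (rule mult_le_mono1) (simp add: K_def)
      then have "2 ^ L * (2 * (K * ?T) + C * ?T) \<le> 2 ^ L * (4 * (K * ?T))"
        by (intro mult_le_mono2) linarith
      also have "\<dots> = K * (2 ^ L * (4 * ?T))" by simp
      also have "\<dots> \<le> K * length_scale \<omega> (?n + L)" by (intro mult_le_mono2 T)
      finally show ?thesis .
    qed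
    ultimately show ?case by (metis (no_types, lifting) add.commute le_trans mult_Suc)
  qed
  have "2 ^ (2 ^ n) \<le> card (ball \<omega> (2 * K * length_scale \<omega> n))" if n: "n = j * L" for n j
  proof -
    define f where "f A = (SOME f. length f \<le> K * length_scale \<omega> n \<and> lamps \<omega> h n (\<lambda>v. v \<in> A) f)" for A
    have f: "length (f A) \<le> K * length_scale \<omega> n" "lamps \<omega> h n (\<lambda>v. v \<in> A) (f A)" for A
    proof -
      have "\<exists>f. length f \<le> K * length_scale \<omega> n \<and> lamps \<omega> h n (\<lambda>v. v \<in> A) f"
        using words[of j] unfolding n by (rule spec)
      from someI_ex[OF this] show "length (f A) \<le> K * length_scale \<omega> n" "lamps \<omega> h n (\<lambda>v. v \<in> A) (f A)"
        unfolding f_def by blast+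
    qed
    let ?V = "{v :: bool list. length v = n}"
    have fin: "finite ?V" and card: "card ?V = 2 ^ n"
      using finite_lists_length_eq[of "UNIV :: bool set" n] card_lists_length_eq[of "UNIV :: bool set" n]
      by (simp_all add: card_UNIV_bool)
    have inj: "inj_on (\<lambda>A. act \<omega> (f A)) (Pow ?V)"
    proof (rule inj_onI)
      fix A B assume AB: "A \<in> Pow ?V" "B \<in> Pow ?V" "act \<omega> (f A) = act \<omega> (f B)"
      show "A = B"
      proof (rule ccontr)
        assume "A \<noteq> B"
        then obtain v where "(v \<in> A) \<noteq> (v \<in> B)" by blast
        moreover from this have "length v = n" using AB by auto
        ultimately show False using lamps_distinct[OF f(2) f(2) w] AB(3) by blast
      qed
    qed
    have "2 ^ (2 ^ n) = card ((\<lambda>A. act \<omega> (f A)) ` Pow ?V)"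
      using card_image[OF inj] card_Pow[OF fin] card by simp
    also have "\<dots> \<le> card (ball \<omega> (2 * K * length_scale \<omega> n))"
      by (rule card_mono[OF finite_ball]) (use f(1) in \<open>auto intro!: act_in_ball\<close>)
    finally show ?thesis .
  qed
  then show ?thesis using L period_pos by (intro exI[of _ L] exI[of _ "2 * K"]) (auto simp: K_def)
qed

end

section \<open>The length scale and the spectral radius\<close>

definition prefix_mat :: "(nat \<Rightarrow> letter) \<Rightarrow> nat \<Rightarrow> complex mat" where
  "prefix_mat \<omega> n = foldr (\<lambda>i A. letter_mat (\<omega> i) * A) [0..<n] (1\<^sub>m 3)"

lemma letter_mat_carrier [simp]: "letter_mat l \<in> carrier_mat 3 3"
  by (cases l) (auto simp: mat_of_rows_list_def)

lemma foldr_letter_mat_carrier: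
  "B \<in> carrier_mat 3 3 \<Longrightarrow> foldr (\<lambda>i A. letter_mat (\<omega> i) * A) ks B \<in> carrier_mat 3 3"
  by (induction ks) (auto intro!: mult_carrier_mat[OF letter_mat_carrier])

lemma foldr_letter_mat:
  assumes "B \<in> carrier_mat 3 3"
  shows "foldr (\<lambda>i A. letter_mat (\<omega> i) * A) ks B = foldr (\<lambda>i A. letter_mat (\<omega> i) * A) ks (1\<^sub>m 3) * B"
proof (induction ks)
  case Nil
  show ?case using left_mult_one_mat[OF assms] by simp
next
  case (Cons k ks)
  show ?case
    unfolding foldr.simps o_apply Cons
    by (rule assoc_mult_mat[OF letter_mat_carrier _ assms, symmetric])
       (rule foldr_letter_mat_carrier[OF one_carrier_mat])
qed

lemma prefix_mat_carrier [simp]: "prefix_mat \<omega> n \<in> carrier_mat 3 3"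
  unfolding prefix_mat_def by (rule foldr_letter_mat_carrier) simp

lemma prefix_mat_0: "prefix_mat \<omega> 0 = 1\<^sub>m 3"
  by (simp add: prefix_mat_def)

lemma prefix_mat_Suc: "prefix_mat \<omega> (Suc n) = prefix_mat \<omega> n * letter_mat (\<omega> n)"
proof -
  have "prefix_mat \<omega> (Suc n) = foldr (\<lambda>i A. letter_mat (\<omega> i) * A) [0..<n] (letter_mat (\<omega> n) * 1\<^sub>m 3)"
    by (simp add: prefix_mat_def)
  also have "\<dots> = foldr (\<lambda>i A. letter_mat (\<omega> i) * A) [0..<n] (letter_mat (\<omega> n))"
    by (simp only: right_mult_one_mat[OF letter_mat_carrier])
  also have "\<dots> = prefix_mat \<omega> n * letter_mat (\<omega> n)"
    unfolding prefix_mat_def by (rule foldr_letter_mat) (rule letter_mat_carrier)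
  finally show ?thesis .
qed

definition column_letter :: "nat \<Rightarrow> klein" where
  "column_letter j = (if j = 0 then Kb else if j = 1 then Kc else Kd)"

lemma letter_mat_entry:
  assumes "i < 3" "j < 3"
  shows "letter_mat l $$ (i, j) =
    of_nat (if column_letter j = vanishes_on l then 1 else if i = j then 2 else 0)"
proof -
  have "i = 0 \<or> i = 1 \<or> i = 2" "j = 0 \<or> j = 1 \<or> j = 2" using assms by auto
  then show ?thesis
    by (cases l) (auto simp: mat_of_rows_list_def column_letter_def numeral_2_eq_2)
qed

lemma sum_3: "(\<Sum>k<3. f k) = f 0 + f 1 + f (2 :: nat)" for f :: "nat \<Rightarrow> 'a :: comm_monoid_add"
  by (simp add: numeral_3_eq_3 numeral_2_eq_2)

text \<open>The column sums of \<open>M(\<omega> 0) \<dots> M(\<omega> (n-1))\<close> are the inflated lengths of the letters \<open>b, c, d\<close>. The products are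
kept as natural number matrices, because norms of complex entries are estimated later.\<close>

lemma prefix_mat_entries:
  "\<exists>f :: nat \<Rightarrow> nat \<Rightarrow> nat. (\<forall>i<3. \<forall>j<3. prefix_mat \<omega> n $$ (i, j) = of_nat (f i j)) \<and>
     (\<forall>j<3. (\<Sum>i<3. f i j) = inflated_length \<omega> n (column_letter j))"
proof (induction n)
  case 0
  show ?case
    by (intro exI[of _ "\<lambda>i j. if i = j then 1 else 0"]) (auto simp: prefix_mat_0)
next
  case (Suc n)
  then obtain f where f: "\<And>i j. i < 3 \<Longrightarrow> j < 3 \<Longrightarrow> prefix_mat \<omega> n $$ (i, j) = of_nat (f i j)"
    "\<And>j. j < 3 \<Longrightarrow> (\<Sum>i<3. f i j) = inflated_length \<omega> n (column_letter j)" by blast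
  define m where "m k j = (if column_letter j = vanishes_on (\<omega> n) then 1 else if k = j then 2 else 0 :: nat)" for k j
  define g where "g i j = (\<Sum>k<3. f i k * m k j)" for i j
  have "prefix_mat \<omega> (Suc n) $$ (i, j) = of_nat (g i j)" if ij: "i < 3" "j < 3" for i j
  proof -
    have dims: "dim_row (prefix_mat \<omega> n) = 3" "dim_col (prefix_mat \<omega> n) = 3"
      "dim_row (letter_mat (\<omega> n)) = 3" "dim_col (letter_mat (\<omega> n)) = 3"
      using prefix_mat_carrier[of \<omega> n] letter_mat_carrier[of "\<omega> n"] by (auto simp del: letter_mat_carrier prefix_mat_carrier)
    have "prefix_mat \<omega> (Suc n) $$ (i, j) = (\<Sum>k<3. prefix_mat \<omega> n $$ (i, k) * letter_mat (\<omega> n) $$ (k, j))"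
      unfolding prefix_mat_Suc using ij dims by (simp add: scalar_prod_def atLeast0LessThan)
    also have "\<dots> = (\<Sum>k<3. of_nat (f i k * m k j))"
      using ij by (intro sum.cong refl) (simp add: f letter_mat_entry m_def)
    finally show ?thesis by (simp add: g_def)
  qed
  moreover have "(\<Sum>i<3. g i j) = inflated_length \<omega> (Suc n) (column_letter j)" if j: "j < 3" for j
  proof -
    have "(\<Sum>i<3. g i j) = (\<Sum>k<3. inflated_length \<omega> n (column_letter k) * m k j)"
      unfolding g_def by (subst sum.swap) (simp add: sum_distrib_right[symmetric] f(2))
    also have "\<dots> = inflated_length \<omega> (Suc n) (column_letter j)"
    proof -
      have "j = 0 \<or> j = 1 \<or> j = 2" using j by auto
      then show ?thesis by (cases "\<omega> n") (auto simp: sum_3 m_def column_letter_def)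
    qed
    finally show ?thesis .
  qed
  ultimately show ?case by (intro exI[of _ g]) blast
qed

lemma sum_inflated_length_columns: "(\<Sum>j<3. inflated_length \<omega> n (column_letter j)) = length_scale \<omega> n"
  using sum_inflated_length[of \<omega> n] by (simp add: sum_3 column_letter_def)

context periodic_sequence
begin

lemma prefix_mat_add: "prefix_mat \<omega> (q + m) = prefix_mat \<omega> q * prefix_mat \<omega> m"
proof (induction m)
  case 0
  show ?case using right_mult_one_mat[OF prefix_mat_carrier] by (simp add: prefix_mat_0)
next
  case (Suc m)
  have "\<omega> (q + m) = \<omega> m" using periodic[of m] by (simp add: add.commute)
  then show ?case using Suc
    by (simp add: prefix_mat_Suc assoc_mult_mat[OF prefix_mat_carrier prefix_mat_carrier letter_mat_carrier])
qed

lemma period_mat_eq: "period_mat \<omega> q = prefix_mat \<omega> q"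
  by (simp only: period_mat_def prefix_mat_def)

lemma period_mat_pow: "period_mat \<omega> q ^\<^sub>m j = prefix_mat \<omega> (j * q)"
proof (induction j)
  case 0
  show ?case using carrier_matD(1)[OF prefix_mat_carrier] by (simp only: pow_mat.simps period_mat_eq prefix_mat_0 mult_0)
next
  case (Suc j)
  have comm: "prefix_mat \<omega> (j * q) * prefix_mat \<omega> q = prefix_mat \<omega> q * prefix_mat \<omega> (j * q)"
  proof (induction j)
    case 0
    show ?case
      by (simp only: mult_0 prefix_mat_0 left_mult_one_mat[OF prefix_mat_carrier] right_mult_one_mat[OF prefix_mat_carrier])
  next
    case (Suc j)
    show ?case
      unfolding mult_Suc prefix_mat_add
      by (simp only: assoc_mult_mat[OF prefix_mat_carrier prefix_mat_carrier prefix_mat_carrier] Suc)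
  qed
  have "period_mat \<omega> q ^\<^sub>m Suc j = period_mat \<omega> q ^\<^sub>m j * period_mat \<omega> q" by (rule pow_mat.simps)
  also have "\<dots> = prefix_mat \<omega> (j * q) * prefix_mat \<omega> q" by (rule arg_cong2[where f = "(*)", OF Suc period_mat_eq])
  also have "\<dots> = prefix_mat \<omega> q * prefix_mat \<omega> (j * q)" by (rule comm)
  also have "\<dots> = prefix_mat \<omega> (Suc j * q)" by (simp only: mult_Suc prefix_mat_add)
  finally show ?case .
qed

lemma period_mat_carrier: "period_mat \<omega> q \<in> carrier_mat 3 3"
  by (simp only: period_mat_eq prefix_mat_carrier)

text \<open>At a coordinate where an eigenvector for the dominant eigenvalue has maximal modulus, the corresponding
row sum of the power bounds the modulus of the eigenvalue's power.\<close>

lemma spectral_radius_pow_le: "spectral_radius (period_mat \<omega> q) ^ j \<le> length_scale \<omega> (j * q)"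
proof -
  let ?A = "period_mat \<omega> q"
  obtain ev where ev: "ev \<in> spectrum ?A" "spectral_radius ?A = norm ev"
    using spectral_radius_mem_max(1)[OF period_mat_carrier] by auto
  then obtain v where v: "eigenvector ?A v ev" by (auto simp: spectrum_def eigenvalue_def)
  then have vc: "v \<in> carrier_vec 3" "v \<noteq> 0\<^sub>v 3"
    using period_mat_carrier by (auto simp: eigenvector_def)
  have pow: "prefix_mat \<omega> (j * q) *\<^sub>v v = ev ^ j \<cdot>\<^sub>v v"
    using eigenvector_pow[OF period_mat_carrier v] by (simp add: period_mat_pow)
  obtain f where f: "\<And>i k. i < 3 \<Longrightarrow> k < 3 \<Longrightarrow> prefix_mat \<omega> (j * q) $$ (i, k) = of_nat (f i k)"
    "\<And>k. k < 3 \<Longrightarrow> (\<Sum>i<3. f i k) = inflated_length \<omega> (j * q) (column_letter k)"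
    using prefix_mat_entries[of \<omega> "j * q"] by auto
  obtain i where i: "i < 3" "\<And>k. k < 3 \<Longrightarrow> norm (v $ k) \<le> norm (v $ i)"
  proof -
    let ?N = "(\<lambda>k. norm (v $ k)) ` {..<3 :: nat}"
    have fin: "finite ?N" by simp
    moreover have "?N \<noteq> {}" by (simp add: lessThan_empty_iff)
    ultimately have "Max ?N \<in> ?N" by (rule Max_in)
    then obtain i where "i < 3" "Max ?N = norm (v $ i)" by auto
    moreover have "norm (v $ k) \<le> Max ?N" if "k < 3" for k
      using Max_ge[OF fin] that by auto
    ultimately show thesis using that by auto
  qed
  have pos: "norm (v $ i) > 0"
  proof (rule ccontr)
    assume "\<not> norm (v $ i) > 0"
    then have "v $ k = 0" if "k < 3" for k using i(2)[OF that] by simp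
    then have "v = 0\<^sub>v 3" using vc(1) by (intro eq_vecI) auto
    then show False using vc(2) by blast
  qed
  have dims: "dim_row (prefix_mat \<omega> (j * q)) = 3" "dim_col (prefix_mat \<omega> (j * q)) = 3"
    using prefix_mat_carrier[of \<omega> "j * q"] by (auto simp del: prefix_mat_carrier)
  have "ev ^ j * v $ i = (ev ^ j \<cdot>\<^sub>v v) $ i" using i(1) vc(1) by auto
  also have "\<dots> = (prefix_mat \<omega> (j * q) *\<^sub>v v) $ i" by (simp add: pow)
  also have "\<dots> = (\<Sum>k<3. of_nat (f i k) * v $ k)"
    using i(1) dims vc(1) by (auto simp: scalar_prod_def atLeast0LessThan f intro!: sum.cong)
  finally have "norm ev ^ j * norm (v $ i) = norm (\<Sum>k<3. of_nat (f i k) * v $ k)"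
    by (simp flip: norm_mult norm_power)
  also have "\<dots> \<le> (\<Sum>k<3. real (f i k) * norm (v $ i))"
    by (intro order_trans[OF norm_sum] sum_mono) (auto simp: norm_mult i(2) intro!: mult_left_mono)
  also have "\<dots> = real (\<Sum>k<3. f i k) * norm (v $ i)" by (simp add: sum_distrib_right)
  also have "\<dots> \<le> real (length_scale \<omega> (j * q)) * norm (v $ i)"
  proof (intro mult_right_mono)
    have "(\<Sum>k<3. f i k) \<le> (\<Sum>k<3. \<Sum>i<3. f i k)"
      using i(1) by (intro sum_mono) (rule member_le_sum[of i "{..<3}" "\<lambda>i. f i _"], auto)
    also have "\<dots> = length_scale \<omega> (j * q)" unfolding sum_inflated_length_columns[symmetric] by (rule sum.cong) (auto simp: f(2))
    finally show "real (\<Sum>k<3. f i k) \<le> real (length_scale \<omega> (j * q))" by (simp only: of_nat_le_iff)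
  qed simp
  finally show ?thesis using pos by (simp add: ev(2))
qed

text \<open>After division by \<open>r\<close> the spectral radius is below \<open>1\<close>, so the powers are bounded.\<close>

lemma length_scale_le_spectral_radius:
  fixes r :: real
  assumes "r > spectral_radius (period_mat \<omega> q)"
  shows "\<exists>c. \<forall>j. real (length_scale \<omega> (j * q)) \<le> c * r ^ j"
proof -
  let ?A = "period_mat \<omega> q"
  have "spectral_radius ?A \<ge> 0"
    using spectral_radius_mem_max(1)[OF period_mat_carrier] by auto
  then have r: "r > 0" using assms by simp
  define B where "B = complex_of_real (1 / r) \<cdot>\<^sub>m ?A"
  have B: "B \<in> carrier_mat 3 3" using period_mat_carrier by (simp add: B_def)
  have Bpow: "B ^\<^sub>m j = complex_of_real (1 / r) ^ j \<cdot>\<^sub>m ?A ^\<^sub>m j" for j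
  proof (induction j)
    case 0
    show ?case using B period_mat_carrier by auto
  next
    case (Suc j)
    have c: "?A ^\<^sub>m j \<in> carrier_mat 3 3" using period_mat_carrier by simp
    let ?a = "complex_of_real (1 / r)"
    have "B ^\<^sub>m Suc j = (?a ^ j \<cdot>\<^sub>m ?A ^\<^sub>m j) * (?a \<cdot>\<^sub>m ?A)"
      by (simp only: pow_mat.simps Suc.IH) (simp only: B_def)
    also have "\<dots> = ?a ^ j \<cdot>\<^sub>m (?a \<cdot>\<^sub>m (?A ^\<^sub>m j * ?A))"
      by (simp only: mult_smult_assoc_mat[OF c smult_carrier_mat[OF period_mat_carrier]]
          mult_smult_distrib[OF c period_mat_carrier])
    also have "\<dots> = ?a ^ Suc j \<cdot>\<^sub>m ?A ^\<^sub>m Suc j"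
      by (rule eq_matI) auto
    finally show ?case .
  qed
  have "spectral_radius B < 1"
  proof -
    obtain e where e: "e \<in> spectrum B" "spectral_radius B = norm e"
      using spectral_radius_mem_max(1)[OF B] by auto
    then obtain v where v: "eigenvector B v e" by (auto simp: spectrum_def eigenvalue_def)
    then have vc: "v \<in> carrier_vec 3" "v \<noteq> 0\<^sub>v 3" "B *\<^sub>v v = e \<cdot>\<^sub>v v"
      using B by (auto simp: eigenvector_def)
    have "?A *\<^sub>v v = complex_of_real r \<cdot>\<^sub>v (B *\<^sub>v v)"
      using period_mat_carrier vc(1) r by (intro eq_vecI) (auto simp: B_def)
    also have "\<dots> = (complex_of_real r * e) \<cdot>\<^sub>v v" by (simp add: vc(3) smult_smult_assoc)
    finally have "eigenvector ?A v (complex_of_real r * e)"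
      using vc period_mat_carrier by (auto simp: eigenvector_def)
    then have "complex_of_real r * e \<in> spectrum ?A" by (auto simp: spectrum_def eigenvalue_def)
    then have "norm (complex_of_real r * e) \<le> spectral_radius ?A"
      using spectral_radius_mem_max(2)[OF period_mat_carrier] by auto
    then have "r * norm e \<le> spectral_radius ?A" using r by (simp add: norm_mult)
    then have "r * norm e < r * 1" using assms by linarith
    then show ?thesis using r unfolding e(2) by (simp only: mult_less_cancel_left_pos)
  qed
  then obtain c where c: "\<And>j. norm_bound (B ^\<^sub>m j) c"
    using spectral_radius_jnf_norm_bound_less_1_upper_triangular[OF B] by blast
  have "real (length_scale \<omega> (j * q)) \<le> (9 * c) * r ^ j" for j
  proof -
    obtain f where f: "\<And>i k. i < 3 \<Longrightarrow> k < 3 \<Longrightarrow> prefix_mat \<omega> (j * q) $$ (i, k) = of_nat (f i k)"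
      "\<And>k. k < 3 \<Longrightarrow> (\<Sum>i<3. f i k) = inflated_length \<omega> (j * q) (column_letter k)"
      using prefix_mat_entries[of \<omega> "j * q"] by auto
    have le: "real (f i k) \<le> c * r ^ j" if ik: "i < 3" "k < 3" for i k
    proof -
      have dims: "dim_row (prefix_mat \<omega> (j * q)) = 3" "dim_col (prefix_mat \<omega> (j * q)) = 3"
        using prefix_mat_carrier[of \<omega> "j * q"] by (auto simp del: prefix_mat_carrier)
      have "norm ((B ^\<^sub>m j) $$ (i, k)) \<le> c"
        using c[of j] ik dims unfolding norm_bound_def Bpow period_mat_pow by auto
      then have "norm (complex_of_real (1 / r) ^ j * of_nat (f i k)) \<le> c"
        using ik dims unfolding Bpow period_mat_pow by (simp add: f)
      then have "(1 / r) ^ j * real (f i k) \<le> c"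
        using r by (simp add: norm_mult norm_power norm_divide)
      then show ?thesis using r by (simp add: field_simps)
    qed
    have "real (length_scale \<omega> (j * q)) = (\<Sum>k<3. \<Sum>i<3. real (f i k))"
      unfolding sum_inflated_length_columns[symmetric] by (simp add: f(2)[symmetric])
    also have "\<dots> \<le> (\<Sum>k<3::nat. \<Sum>i<3::nat. c * r ^ j)" by (intro sum_mono) (use le in auto)
    finally show ?thesis by (simp add: sum_3)
  qed
  then show ?thesis by blast
qed

end

context periodic_sequence
begin

section \<open>The growth exponent\<close>

lemma spectral_radius_ge: "spectral_radius (period_mat \<omega> q) \<ge> 2 ^ q"
proof (rule ccontr)
  let ?\<Lambda> = "spectral_radius (period_mat \<omega> q)"
  assume "\<not> ?thesis"
  then obtain r where r: "?\<Lambda> < r" "r < 2 ^ q" using dense[of ?\<Lambda> "2 ^ q"] by auto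
  have "?\<Lambda> \<ge> 0" using spectral_radius_mem_max(1)[OF period_mat_carrier] by auto
  then have rpos: "r > 0" using r by simp
  obtain c where c: "\<And>j. real (length_scale \<omega> (j * q)) \<le> c * r ^ j"
    using length_scale_le_spectral_radius[OF r(1)] by auto
  have "((2 ^ q) / r) ^ j \<le> c" for j
  proof -
    have "(2 ^ q) ^ j \<le> real (length_scale \<omega> (j * q))"
    proof -
      have "real (2 ^ (j * q)) \<le> real (length_scale \<omega> (j * q))"
        using length_scale_ge_pow[of "j * q"] by (simp only: of_nat_le_iff)
      moreover have "real (2 ^ (j * q)) = (2 ^ q) ^ j"
        by (simp only: of_nat_power of_nat_numeral power_mult[symmetric] mult.commute)
      ultimately show ?thesis by (simp only:)
    qed
    then have "(2 ^ q) ^ j \<le> c * r ^ j" using c[of j] by (rule order_trans)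
    then show ?thesis unfolding power_divide using rpos by (subst pos_divide_le_eq) auto
  qed
  moreover obtain j where "((2 ^ q) / r) ^ j > c"
    using real_arch_pow[of "2 ^ q / r" c] r(2) rpos by auto
  ultimately show False by (meson not_le)
qed

lemma ln_spectral_radius_pos: "ln (spectral_radius (period_mat \<omega> q)) > 0"
proof -
  have "(2 :: real) \<le> 2 ^ q" using power_increasing[of 1 q "2 :: real"] period_pos by simp
  then show ?thesis using spectral_radius_ge by (intro ln_gt_zero) linarith
qed

lemma ln_length_scale_multiples:
  "(\<lambda>j. ln (real (length_scale \<omega> (j * q))) / real j) \<longlonglongrightarrow> ln (spectral_radius (period_mat \<omega> q))"
proof (rule LIMSEQ_I)
  let ?\<Lambda> = "spectral_radius (period_mat \<omega> q)" and ?t = "\<lambda>j. ln (real (length_scale \<omega> (j * q)))"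
  fix e :: real assume e: "e > 0"
  have pos: "?\<Lambda> > 0" using spectral_radius_ge by (rule less_le_trans[rotated]) simp
  have T: "real (length_scale \<omega> n) > 0" for n using length_scale_ge[of \<omega> n] by simp
  define r where "r = ?\<Lambda> * exp (e / 2)"
  have r: "r > ?\<Lambda>" "r > 0" using pos e by (simp_all add: r_def)
  obtain c where c: "\<And>j. real (length_scale \<omega> (j * q)) \<le> c * r ^ j"
    using length_scale_le_spectral_radius[OF r(1)] by auto
  have cpos: "c > 0" using c[of 0] T[of 0] by simp
  obtain N where N: "real N > 2 * \<bar>ln c\<bar> / e" using reals_Archimedean2 by blast
  have "norm (?t j / real j - ln ?\<Lambda>) < e" if j: "j \<ge> max 1 N" for j
  proof -
    have "real j * ln ?\<Lambda> = ln (?\<Lambda> ^ j)" using pos by (simp add: ln_realpow)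
    also have "\<dots> \<le> ?t j" using spectral_radius_pow_le[of j] pos T by (subst ln_le_cancel_iff) auto
    finally have low: "real j * ln ?\<Lambda> \<le> ?t j" .
    have "?t j \<le> ln (c * r ^ j)" using c[of j] T[of "j * q"] cpos r by (subst ln_le_cancel_iff) auto
    also have "\<dots> = ln c + real j * (ln ?\<Lambda> + e / 2)"
      using cpos r pos by (simp add: ln_mult ln_realpow r_def)
    finally have up: "?t j \<le> ln c + real j * (ln ?\<Lambda> + e / 2)" .
    have "2 * \<bar>ln c\<bar> / e < real j" using N j by simp
    then have "ln c < real j * (e / 2)" using e by (simp add: field_simps)
    then have "?t j < real j * (ln ?\<Lambda> + e)" using up by (simp add: algebra_simps)
    then have "?t j / real j < ln ?\<Lambda> + e" using j by (simp add: field_simps)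
    moreover have "?t j / real j \<ge> ln ?\<Lambda>" using low j by (simp add: field_simps)
    ultimately show ?thesis using e by simp
  qed
  then show "\<exists>no. \<forall>n\<ge>no. norm (?t n / real n - ln ?\<Lambda>) < e" by blast
qed

lemma ln_length_scale:
  "(\<lambda>n. ln (real (length_scale \<omega> n)) / real n) \<longlonglongrightarrow> ln (spectral_radius (period_mat \<omega> q)) / real q"
proof -
  let ?\<Lambda> = "spectral_radius (period_mat \<omega> q)" and ?t = "\<lambda>n. ln (real (length_scale \<omega> n))"
  have T: "real (length_scale \<omega> n) > 0" for n using length_scale_ge[of \<omega> n] by simp
  have div_top: "filterlim (\<lambda>n. n div q) at_top sequentially"
    using period_pos by (intro filterlim_at_top_div_const_nat) simp
  have A: "(\<lambda>n. ?t (n div q * q) / real (n div q)) \<longlonglongrightarrow> ln ?\<Lambda>"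
    by (rule filterlim_compose[OF ln_length_scale_multiples div_top])
  have B: "(\<lambda>n. real (n div q) / real n) \<longlonglongrightarrow> 1 / real q"
  proof (rule tendsto_sandwich)
    show "\<forall>\<^sub>F n in sequentially. 1 / real q - 1 / real n \<le> real (n div q) / real n"
    proof (intro eventually_sequentiallyI[of 1])
      fix n :: nat assume n: "n \<ge> 1"
      have "n \<le> n div q * q + q"
        using div_mult_mod_eq[of n q] mod_less_divisor[of q n] period_pos by linarith
      then have "real n \<le> real (n div q) * real q + real q"
        by (metis of_nat_add of_nat_le_iff of_nat_mult)
      then have "(real n - real q) / (real n * real q) \<le> real (n div q) * real q / (real n * real q)"
        by (intro divide_right_mono) auto
      then show "1 / real q - 1 / real n \<le> real (n div q) / real n"
        using n period_pos by (simp add: diff_divide_distrib)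
    qed
    show "\<forall>\<^sub>F n in sequentially. real (n div q) / real n \<le> 1 / real q"
    proof (intro eventually_sequentiallyI[of 1])
      fix n :: nat assume n: "n \<ge> 1"
      have "real (n div q) * real q \<le> real n" by (metis div_times_less_eq_dividend of_nat_le_iff of_nat_mult)
      then show "real (n div q) / real n \<le> 1 / real q"
        using n period_pos by (simp add: field_simps)
    qed
    show "(\<lambda>n. 1 / real q - 1 / real n) \<longlonglongrightarrow> 1 / real q"
      using tendsto_diff[OF tendsto_const lim_1_over_n, of "1 / real q"] by simp
  qed simp
  have C: "(\<lambda>n. (?t n - ?t (n div q * q)) / real n) \<longlonglongrightarrow> 0"
  proof (rule tendsto_sandwich)
    have le: "n div q * q \<le> n" for n by simp
    show "\<forall>\<^sub>F n in sequentially. 0 \<le> (?t n - ?t (n div q * q)) / real n"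
      using length_scale_mono[OF le] T by (intro always_eventually allI divide_nonneg_nonneg) simp_all
    show "\<forall>\<^sub>F n in sequentially. (?t n - ?t (n div q * q)) / real n \<le> real q * ln 3 * (1 / real n)"
    proof (intro always_eventually allI)
      fix n
      have "length_scale \<omega> n \<le> 3 ^ (n mod q) * length_scale \<omega> (n div q * q)"
        using length_scale_add_le[of \<omega> "n div q * q" "n mod q"] by simp
      also have "\<dots> \<le> 3 ^ q * length_scale \<omega> (n div q * q)"
        using period_pos by (intro mult_right_mono power_increasing) (auto simp: less_imp_le)
      finally have "real (length_scale \<omega> n) \<le> real (3 ^ q * length_scale \<omega> (n div q * q))"
        by (simp only: of_nat_le_iff)
      then have "real (length_scale \<omega> n) \<le> 3 ^ q * real (length_scale \<omega> (n div q * q))" by simp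
      then have "?t n \<le> ln (3 ^ q * real (length_scale \<omega> (n div q * q)))"
        using T by (subst ln_le_cancel_iff) auto
      also have "\<dots> = real q * ln 3 + ?t (n div q * q)"
        using T by (subst ln_mult) (auto simp: ln_realpow)
      finally have "?t n - ?t (n div q * q) \<le> real q * ln 3" by simp
      then show "(?t n - ?t (n div q * q)) / real n \<le> real q * ln 3 * (1 / real n)"
        by (simp add: divide_right_mono)
    qed
    show "(\<lambda>n. real q * ln 3 * (1 / real n)) \<longlonglongrightarrow> 0"
      using tendsto_mult_right_zero[OF lim_1_over_n] by simp
  qed simp
  have "(\<lambda>n. ?t (n div q * q) / real (n div q) * (real (n div q) / real n) + (?t n - ?t (n div q * q)) / real n)
      \<longlonglongrightarrow> ln ?\<Lambda> * (1 / real q) + 0"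
    by (intro tendsto_add tendsto_mult A B C)
  moreover have "\<forall>\<^sub>F n in sequentially.
      ?t (n div q * q) / real (n div q) * (real (n div q) / real n) + (?t n - ?t (n div q * q)) / real n
      = ?t n / real n"
  proof (intro eventually_sequentiallyI[of q])
    fix n assume "n \<ge> q"
    then have "n div q > 0" using period_pos by (simp add: div_greater_zero_iff)
    then show "?t (n div q * q) / real (n div q) * (real (n div q) / real n) + (?t n - ?t (n div q * q)) / real n
      = ?t n / real n" by (simp add: diff_divide_distrib)
  qed
  ultimately show ?thesis by (simp add: tendsto_cong)
qed

text \<open>The level at which balls of radius \<open>n\<close> live. Both logarithms in the growth exponent are compared with it.\<close>

definition scale_index :: "nat \<Rightarrow> nat" where
  "scale_index n = (LEAST m. n \<le> length_scale \<omega> m)"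

lemma scale_index_upper: "n \<le> length_scale \<omega> (scale_index n)"
  unfolding scale_index_def
proof (rule LeastI)
  show "n \<le> length_scale \<omega> n" using length_scale_ge_pow[of n] less_exp[of n] by linarith
qed

lemma scale_index_lower: "m < scale_index n \<Longrightarrow> length_scale \<omega> m < n"
  unfolding scale_index_def using not_less_Least by fastforce

lemma scale_index_at_top: "filterlim scale_index at_top sequentially"
  unfolding filterlim_at_top
proof
  fix M
  have "scale_index n \<ge> M" if n: "n \<ge> Suc (length_scale \<omega> M)" for n
  proof (rule ccontr)
    assume "\<not> scale_index n \<ge> M"
    then have "length_scale \<omega> (scale_index n) \<le> length_scale \<omega> M" by (intro length_scale_mono) simp
    then show False using scale_index_upper[of n] n by simp
  qed
  then show "\<forall>\<^sub>F n in sequentially. M \<le> scale_index n" by (rule eventually_sequentiallyI)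
qed

lemma scale_index_eventually_ge: "\<forall>\<^sub>F n in sequentially. scale_index n \<ge> k"
  using scale_index_at_top unfolding filterlim_at_top by blast

lemma inverse_scale_index: "(\<lambda>n. c / real (scale_index n)) \<longlonglongrightarrow> 0"
  by (rule filterlim_compose[OF _ scale_index_at_top]) (rule lim_const_over_n)

lemma ln_over_scale_index: "(\<lambda>n. ln (real n) / real (scale_index n)) \<longlonglongrightarrow> ln (spectral_radius (period_mat \<omega> q)) / real q"
proof -
  let ?t = "\<lambda>n. ln (real (length_scale \<omega> n))"
  let ?\<rho> = "ln (spectral_radius (period_mat \<omega> q)) / real q"
  have T: "real (length_scale \<omega> n) > 0" for n using length_scale_ge[of \<omega> n] by simp
  have lim: "(\<lambda>n. ?t (scale_index n) / real (scale_index n)) \<longlonglongrightarrow> ?\<rho>"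
    by (rule filterlim_compose[OF ln_length_scale scale_index_at_top])
  show ?thesis
  proof (rule tendsto_sandwich[OF _ _ _ lim])
    show "(\<lambda>n. ?t (scale_index n) / real (scale_index n) - ln 3 / real (scale_index n)) \<longlonglongrightarrow> ?\<rho>"
      using tendsto_diff[OF lim inverse_scale_index[of "ln 3"]] by simp
    show "\<forall>\<^sub>F n in sequentially. ?t (scale_index n) / real (scale_index n) - ln 3 / real (scale_index n) \<le> ln (real n) / real (scale_index n)"
      using scale_index_eventually_ge[of 1]
    proof eventually_elim
      case (elim n)
      then obtain m where m: "scale_index n = Suc m" by (cases "scale_index n") auto
      then have "length_scale \<omega> m < n" by (intro scale_index_lower) simp
      moreover have "length_scale \<omega> (scale_index n) \<le> 3 * length_scale \<omega> m" using length_scale_Suc_le m by simp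
      ultimately have "real (length_scale \<omega> (scale_index n)) \<le> 3 * real n" by linarith
      then have "?t (scale_index n) \<le> ln (3 * real n)" using T[of "scale_index n"] by (subst ln_le_cancel_iff) linarith+
      also have "\<dots> = ln 3 + ln (real n)"
        using \<open>length_scale \<omega> m < n\<close> by (subst ln_mult) auto
      finally show ?case by (simp add: diff_divide_distrib[symmetric] divide_right_mono)
    qed
    show "\<forall>\<^sub>F n in sequentially. ln (real n) / real (scale_index n) \<le> ?t (scale_index n) / real (scale_index n)"
    proof (intro eventually_sequentiallyI[of 1] divide_right_mono)
      fix n :: nat assume "n \<ge> 1"
      then show "ln (real n) \<le> ?t (scale_index n)" using scale_index_upper[of n] by (subst ln_le_cancel_iff) auto
    qed simp
  qed
qed

text \<open>The upper bound applies at the level \<open>scale_index n\<close> itself, the lower bound at the largest multiple of \<open>L\<close>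
that is at most \<open>scale_index n - Suc K\<close>. The double logarithms of the bounds differ by a bounded amount.\<close>

lemma ln_ln_card_ball_over_scale_index: "(\<lambda>n. ln (ln (real (card (ball \<omega> n)))) / real (scale_index n)) \<longlonglongrightarrow> ln 2"
proof -
  obtain L K where L: "L \<ge> 1" and low: "\<And>j. 2 ^ (2 ^ (j * L)) \<le> card (ball \<omega> (K * length_scale \<omega> (j * L)))"
    using card_ball_ge by blast
  define s where "s = K + L"
  define C where "C = real (4 * 3 ^ Suc q + 2) * ln 7"
  have "real (4 * 3 ^ Suc q + 2) > 0" by (simp only: of_nat_0_less_iff)
  then have C: "C > 0" unfolding C_def by (intro mult_pos_pos) auto
  have bounds: "(real (scale_index n) - real (Suc s)) * ln 2 + ln (ln 2) \<le> ln (ln (real (card (ball \<omega> n))))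
      \<and> ln (ln (real (card (ball \<omega> n)))) \<le> ln C + real (scale_index n) * ln 2"
    if n: "scale_index n \<ge> Suc s" for n
  proof -
    \<comment> \<open>\<open>K\<close> further levels multiply the length scale by \<open>2^K \<ge> K\<close>, which absorbs the constant \<open>K\<close> of the radius\<close>
    define m where "m = scale_index n - Suc K"
    define j where "j = m div L"
    have "j * L \<le> m" by (simp add: j_def)
    have "m < j * L + L" using div_mult_mod_eq[of m L] mod_less_divisor[of L m] L unfolding j_def by linarith
    then have jL: "real (scale_index n) - real (Suc s) \<le> real (j * L)" using n unfolding m_def s_def by linarith
    have "K * length_scale \<omega> (j * L) \<le> 2 ^ K * length_scale \<omega> m"
      using length_scale_mono[OF \<open>j * L \<le> m\<close>] less_exp[of K] by (intro mult_mono) auto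
    also have "\<dots> \<le> length_scale \<omega> (m + K)"
    proof (induction K)
      case (Suc K)
      then show ?case by (simp add: length_scale_Suc)
    qed simp
    also have "\<dots> \<le> n"
      using scale_index_lower[of "m + K" n] n unfolding m_def s_def by simp
    finally have "2 ^ (2 ^ (j * L)) \<le> card (ball \<omega> n)"
      using low[of j] card_ball_mono le_trans by blast
    then have v: "(2 :: real) ^ (2 ^ (j * L)) \<le> real (card (ball \<omega> n))"
      by (metis of_nat_le_iff of_nat_numeral of_nat_power)
    have vpos: "0 < real (card (ball \<omega> n))" by (rule less_le_trans[OF _ v]) simp
    have "ln ((2 :: real) ^ (2 ^ (j * L))) \<le> ln (real (card (ball \<omega> n)))"
      using v vpos by (subst ln_le_cancel_iff) simp_all
    then have lnv: "2 ^ (j * L) * ln 2 \<le> ln (real (card (ball \<omega> n)))" by (simp add: ln_realpow)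
    have pos: "0 < (2 :: real) ^ (j * L) * ln 2" by simp
    have "ln (2 ^ (j * L) * ln 2) \<le> ln (ln (real (card (ball \<omega> n))))"
      using lnv pos by (subst ln_le_cancel_iff) (auto intro: less_le_trans[OF pos lnv])
    then have "real (j * L) * ln 2 + ln (ln 2) \<le> ln (ln (real (card (ball \<omega> n))))"
      by (subst (asm) ln_mult) (auto simp: ln_realpow)
    moreover have "(real (scale_index n) - real (Suc s)) * ln 2 \<le> real (j * L) * ln 2"
      using jL by (intro mult_right_mono) auto
    ultimately have 1: "(real (scale_index n) - real (Suc s)) * ln 2 + ln (ln 2) \<le> ln (ln (real (card (ball \<omega> n))))"
      by linarith
    have lnpos: "0 < ln (real (card (ball \<omega> n)))" by (rule less_le_trans[OF pos lnv])
    have "real (card (ball \<omega> n)) \<le> 7 ^ ((4 * 3 ^ Suc q + 2) * 2 ^ scale_index n)"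
      using card_ball_le[OF scale_index_upper[of n]] by (metis of_nat_le_iff of_nat_numeral of_nat_power)
    then have "ln (real (card (ball \<omega> n))) \<le> ln (7 ^ ((4 * 3 ^ Suc q + 2) * 2 ^ scale_index n))"
      using vpos by (subst ln_le_cancel_iff) auto
    also have "\<dots> = C * 2 ^ scale_index n" unfolding C_def by (subst ln_realpow) (auto simp: algebra_simps)
    finally have "ln (ln (real (card (ball \<omega> n)))) \<le> ln (C * 2 ^ scale_index n)"
      using lnpos C by (subst ln_le_cancel_iff) auto
    also have "\<dots> = ln C + real (scale_index n) * ln 2" using C by (subst ln_mult) (auto simp: ln_realpow)
    finally show ?thesis using 1 by blast
  qed
  let ?c = "ln (ln 2) - real (Suc s) * ln 2"
  show ?thesis
  proof (rule tendsto_sandwich)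
    show "\<forall>\<^sub>F n in sequentially. ln 2 + ?c / real (scale_index n) \<le> ln (ln (real (card (ball \<omega> n)))) / real (scale_index n)"
      using scale_index_eventually_ge[of "Suc s"]
    proof eventually_elim
      case (elim n)
      then have "real (scale_index n) > 0" by simp
      moreover have "real (scale_index n) * ln 2 + ?c \<le> ln (ln (real (card (ball \<omega> n))))"
        using bounds[OF elim] by (simp add: algebra_simps)
      ultimately have "(real (scale_index n) * ln 2 + ?c) / real (scale_index n)
          \<le> ln (ln (real (card (ball \<omega> n)))) / real (scale_index n)"
        by (intro divide_right_mono) auto
      then show ?case using \<open>real (scale_index n) > 0\<close>
        unfolding add_divide_distrib by (simp only: nonzero_mult_div_cancel_left[OF less_imp_neq[THEN not_sym]])
    qed
    show "\<forall>\<^sub>F n in sequentially. ln (ln (real (card (ball \<omega> n)))) / real (scale_index n) \<le> ln 2 + ln C / real (scale_index n)"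
      using scale_index_eventually_ge[of "Suc s"]
    proof eventually_elim
      case (elim n)
      then have "real (scale_index n) > 0" by simp
      then show ?case using bounds[OF elim] by (simp add: field_simps)
    qed
    show "(\<lambda>n. ln 2 + ?c / real (scale_index n)) \<longlonglongrightarrow> ln 2"
      using tendsto_add[OF tendsto_const inverse_scale_index] by simp
    show "(\<lambda>n. ln 2 + ln C / real (scale_index n)) \<longlonglongrightarrow> ln 2"
      using tendsto_add[OF tendsto_const inverse_scale_index] by simp
  qed
qed

lemma growth_exponent:
  "(\<lambda>n. ln (ln (real (growth (grigorchuk_group \<omega>) (grigorchuk_gens \<omega>) n))) / ln (real n))
     \<longlonglongrightarrow> real q * ln 2 / ln (spectral_radius (period_mat \<omega> q))"
proof -
  let ?l = "ln (spectral_radius (period_mat \<omega> q))"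
  have "?l / real q \<noteq> 0" using ln_spectral_radius_pos period_pos by simp
  from tendsto_divide[OF ln_ln_card_ball_over_scale_index ln_over_scale_index this]
  have "(\<lambda>n. ln (ln (real (card (ball \<omega> n)))) / real (scale_index n) / (ln (real n) / real (scale_index n)))
      \<longlonglongrightarrow> real q * ln 2 / ?l" by (simp add: mult.commute)
  moreover have "\<forall>\<^sub>F n in sequentially.
      ln (ln (real (card (ball \<omega> n)))) / real (scale_index n) / (ln (real n) / real (scale_index n)) =
      ln (ln (real (growth (grigorchuk_group \<omega>) (grigorchuk_gens \<omega>) n))) / ln (real n)"
    using scale_index_eventually_ge[of 1]
  proof eventually_elim
    case (elim n)
    then show ?case by (simp add: growth_eq_card_ball)
  qed
  ultimately show ?thesis by (rule Lim_transform_eventually)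
qed

end

theorem theorem2:
  fixes \<omega> :: "nat \<Rightarrow> letter" and q :: nat
  assumes "q \<ge> 1"
    and "\<And>n. \<omega> (n + q) = \<omega> n"
    and "range \<omega> = {L0, L1, L2}"
  shows "(\<lambda>n. ln (ln (real (growth (grigorchuk_group \<omega>) (grigorchuk_gens \<omega>) n))) / ln (real n))
           \<longlonglongrightarrow> real q * ln 2 / ln (spectral_radius (period_mat \<omega> q))"
proof -
  interpret periodic_sequence \<omega> q using assms by unfold_locales
  show ?thesis by (rule growth_exponent)
qed

end
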